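(* Let $\mathfrak{g}$ be an almost abelian Lie algebra of real dimension $2n$, with codimension-one abelian ideal $\mathfrak{n}$, endowed with a complex structure $J$, let $\mathfrak{n}_1=\mathfrak{n}\cap J\mathfrak{n}$, and let $(e_1,\dots,e_{2n})$ be a $J$-adapted basis of $\mathfrak{g}$. Then $\mathfrak{g}$ admits a twisted SKT $J$-Hermitian metric if and only if the endomorphism $\mathrm{ad}_{e_{2n}}|_{\mathfrak{n}_1}$ of $\mathfrak{n}_1$ satisfies the following two conditions: (i) $\mathrm{ad}_{e_{2n}}|_{\mathfrak{n}_1}$ is diagonalizable over $\mathbb{C}$; and (ii) there exists $\mu\in\mathbb{R}$ such that $\mathrm{Re}(\lambda)\in\{0,\mu\}$ for every $\lambda\in\mathrm{Spec}(\mathrm{ad}_{e_{2n}}|_{\mathfrak{n}_1})$. Moreover, if $\mathrm{ad}_{e_{2n}}|_{\mathfrak{n}_1}$ satisfies (i) and (ii), then the twisted SKT $J$-Hermitian metrics on $\mathfrak{g}$ are exactly all the inner products $g'$ on $\mathfrak{g}$ compatible with $J$ and such that $\mathrm{ad}_{e_{2n}}|_{\mathfrak{n}_1}$ is $g'$-normal.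
   Context: All Lie algebras are real and finite-dimensional. An almost abelian Lie algebra is a non-abelian Lie algebra $\mathfrak{g}$ with a codimension-one abelian ideal $\mathfrak{n}$ (fixed throughout). A complex structure on $\mathfrak{g}$ is an endomorphism $J$ with $J^2=-\mathrm{id}$ and $[JX,JY]-[X,Y]-J[JX,Y]-J[X,JY]=0$ for all $X,Y$. A $J$-Hermitian metric is an inner product $g$ on $\mathfrak{g}$ compatible with $J$, i.e. $g(JX,JY)=g(X,Y)$. Its fundamental form is $\omega(X,Y)=g(JX,Y)$ and its Bismut torsion 3-form is $H(X,Y,Z)=-d\omega(JX,JY,JZ)$, where $d$ is the Chevalley–Eilenberg differential (on 1-forms, $d\alpha(X,Y)=-\alpha([X,Y])$). The metric $g$ (or the pair $(J,g)$) is called twisted SKT if $dH=\alpha\wedge H$ for some closed 1-form $\alpha\in\mathfrak{g}^*$ (possibly zero). A $J$-adapted basis of $\mathfrak{g}$ is a basis $(e_1,\dots,e_{2n})$ with $\mathfrak{n}_1=\mathrm{span}\langle e_2,\dots,e_{2n-1}\rangle$, $\mathfrak{n}=\mathrm{span}\langle e_1,\dots,e_{2n-1}\rangle$, $Je_1=e_{2n}$, $Je_2=e_3$, ..., $Je_{2n-2}=e_{2n-1}$. Such bases exist, and since $J$ is integrable $\mathrm{ad}_{e_{2n}}$ preserves $\mathfrak{n}_1$; the endomorphism $\mathrm{ad}_{e_{2n}}|_{\mathfrak{n}_1}$ does not depend on the $J$-adapted basis up to a non-zero real scalar. An endomorphism of $\mathfrak{n}_1$ is $g'$-normal if it commutes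 with its adjoint with respect to $g'|_{\mathfrak{n}_1}$. *)

theory Defs
  imports "HOL-Analysis.Analysis"
begin

section \<open>Lie algebras and complex structures\<close>

text \<open>The underlying vector space is a whole type of class \<open>real_vector\<close>, so that no inner
  product or topology is fixed in advance.\<close>

locale lie_algebra =
  fixes br :: "'a::real_vector \<Rightarrow> 'a \<Rightarrow> 'a"
  assumes finite_dim: "\<exists>B::'a set. finite B \<and> span B = UNIV"
    and bilinear_br: "bilinear br"
    and br_self: "br x x = 0"
    and jacobi: "br x (br y z) + br y (br z x) + br z (br x y) = 0"

definition abelian_ideal :: "('a::real_vector \<Rightarrow> 'a \<Rightarrow> 'a) \<Rightarrow> 'a set \<Rightarrow> bool" where
  "abelian_ideal br N \<longleftrightarrow>
     subspace N \<and> (\<forall>x. \<forall>y\<in>N. br x y \<in> N) \<and> (\<forall>x\<in>N. \<forall>y\<in>N. br x y = 0)"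

definition almost_abelian :: "('a::real_vector \<Rightarrow> 'a \<Rightarrow> 'a) \<Rightarrow> 'a set \<Rightarrow> bool" where
  "almost_abelian br N \<longleftrightarrow>
     lie_algebra br \<and> (\<exists>x y. br x y \<noteq> 0) \<and>
     abelian_ideal br N \<and> dim N + 1 = dim (UNIV :: 'a set)"

definition complex_structure ::
  "('a::real_vector \<Rightarrow> 'a \<Rightarrow> 'a) \<Rightarrow> ('a \<Rightarrow> 'a) \<Rightarrow> bool" where
  "complex_structure br J \<longleftrightarrow>
     linear J \<and> (\<forall>x. J (J x) = - x) \<and>
     (\<forall>x y. br (J x) (J y) - br x y - J (br (J x) y) - J (br x (J y)) = 0)"

definition n1 :: "('a::real_vector \<Rightarrow> 'a) \<Rightarrow> 'a set \<Rightarrow> 'a set" where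
  "n1 J N = N \<inter> J ` N"

text \<open>Bases are indexed from 1, as families whose values outside \<open>{1..2 * n}\<close> are irrelevant.\<close>

definition adapted_basis ::
  "('a::real_vector \<Rightarrow> 'a) \<Rightarrow> 'a set \<Rightarrow> nat \<Rightarrow> (nat \<Rightarrow> 'a) \<Rightarrow> bool" where
  "adapted_basis J N n e \<longleftrightarrow>
     inj_on e {1..2 * n} \<and> independent (e ` {1..2 * n}) \<and> span (e ` {1..2 * n}) = UNIV \<and>
     span (e ` {2..<2 * n}) = n1 J N \<and> span (e ` {1..<2 * n}) = N \<and>
     J (e 1) = e (2 * n) \<and> (\<forall>k. 1 \<le> k \<and> k < n \<longrightarrow> J (e (2 * k)) = e (2 * k + 1))"

section \<open>Forms and the Chevalley--Eilenberg differential\<close>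

text \<open>A \<open>k\<close>-form is represented by a function on lists, of which only the values on lists of
  length \<open>k\<close> matter. With arguments \<open>X\<^sub>0, \<dots>, X\<^sub>k\<close>, the differential is
  \<open>\<Sum>i<j. (-1)^(i+j) \<omega>([X\<^sub>i, X\<^sub>j], X\<^sub>0, \<dots>, X\<^sub>k)\<close> with \<open>X\<^sub>i, X\<^sub>j\<close> omitted;
  \<open>nths Xs (- {i, j})\<close> is the list \<open>Xs\<close> without the entries at positions \<open>i\<close> and \<open>j\<close>.\<close>

definition ce_d ::
  "('a \<Rightarrow> 'a \<Rightarrow> 'a) \<Rightarrow> ('a list \<Rightarrow> real) \<Rightarrow> 'a list \<Rightarrow> real" where
  "ce_d br \<omega> Xs =
     (\<Sum>j<length Xs. \<Sum>i<j. (- 1) ^ (i + j) * \<omega> (br (Xs ! i) (Xs ! j) # nths Xs (- {i, j})))"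

definition one_form :: "('a \<Rightarrow> real) \<Rightarrow> 'a list \<Rightarrow> real" where
  "one_form \<alpha> Xs = \<alpha> (Xs ! 0)"

definition wedge1 :: "('a \<Rightarrow> real) \<Rightarrow> ('a list \<Rightarrow> real) \<Rightarrow> 'a list \<Rightarrow> real" where
  "wedge1 \<alpha> \<beta> Xs = (\<Sum>i<length Xs. (- 1) ^ i * \<alpha> (Xs ! i) * \<beta> (nths Xs (- {i})))"

lemma ce_d_one_form: "ce_d br (one_form \<alpha>) [X, Y] = - \<alpha> (br X Y)"
  by (simp add: ce_d_def one_form_def numeral_2_eq_2)

lemma ce_d_2: "ce_d br \<omega> [X, Y, Z] =
    - \<omega> [br X Y, Z] + \<omega> [br X Z, Y] - \<omega> [br Y Z, X]"
  by (simp add: ce_d_def numeral_eq_Suc nths_Cons)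

lemma ce_d_3: "ce_d br H [X, Y, Z, W] =
    - H [br X Y, Z, W] + H [br X Z, Y, W] - H [br X W, Y, Z]
    - H [br Y Z, X, W] + H [br Y W, X, Z] - H [br Z W, X, Y]"
  by (simp add: ce_d_def numeral_eq_Suc nths_Cons)

lemma wedge1_3: "wedge1 \<alpha> H [X, Y, Z, W] =
    \<alpha> X * H [Y, Z, W] - \<alpha> Y * H [X, Z, W] + \<alpha> Z * H [X, Y, W] - \<alpha> W * H [X, Y, Z]"
  by (simp add: wedge1_def numeral_eq_Suc nths_Cons)

section \<open>Twisted SKT metrics\<close>

definition inner_product :: "('a::real_vector \<Rightarrow> 'a \<Rightarrow> real) \<Rightarrow> bool" where
  "inner_product g \<longleftrightarrow>
     bilinear g \<and> (\<forall>x y. g x y = g y x) \<and> (\<forall>x. x \<noteq> 0 \<longrightarrow> g x x > 0)"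

definition hermitian_metric ::
  "('a::real_vector \<Rightarrow> 'a) \<Rightarrow> ('a \<Rightarrow> 'a \<Rightarrow> real) \<Rightarrow> bool" where
  "hermitian_metric J g \<longleftrightarrow> inner_product g \<and> (\<forall>x y. g (J x) (J y) = g x y)"

definition fundamental_form ::
  "('a \<Rightarrow> 'a) \<Rightarrow> ('a \<Rightarrow> 'a \<Rightarrow> real) \<Rightarrow> 'a list \<Rightarrow> real" where
  "fundamental_form J g Xs = g (J (Xs ! 0)) (Xs ! 1)"

definition bismut_torsion ::
  "('a \<Rightarrow> 'a \<Rightarrow> 'a) \<Rightarrow> ('a \<Rightarrow> 'a) \<Rightarrow> ('a \<Rightarrow> 'a \<Rightarrow> real) \<Rightarrow> 'a list \<Rightarrow> real" where
  "bismut_torsion br J g Xs = - ce_d br (fundamental_form J g) (map J Xs)"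

definition twisted_SKT ::
  "('a::real_vector \<Rightarrow> 'a \<Rightarrow> 'a) \<Rightarrow> ('a \<Rightarrow> 'a) \<Rightarrow> ('a \<Rightarrow> 'a \<Rightarrow> real) \<Rightarrow> bool" where
  "twisted_SKT br J g \<longleftrightarrow>
     hermitian_metric J g \<and>
     (\<exists>\<alpha>. linear \<alpha> \<and> (\<forall>X Y. ce_d br (one_form \<alpha>) [X, Y] = 0) \<and>
        (\<forall>X Y Z W. ce_d br (bismut_torsion br J g) [X, Y, Z, W] =
           wedge1 \<alpha> (bismut_torsion br J g) [X, Y, Z, W]))"

section \<open>Endomorphisms of a subspace\<close>

text \<open>In the following, \<open>f\<close> is a linear map leaving the subspace \<open>V\<close> invariant, and it is its
  restriction to \<open>V\<close> that is meant. The adjoint \<open>h\<close> is unique on \<open>V\<close>, and linear there.\<close>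

definition normal_on ::
  "'a set \<Rightarrow> ('a \<Rightarrow> 'a \<Rightarrow> real) \<Rightarrow> ('a \<Rightarrow> 'a) \<Rightarrow> bool" where
  "normal_on V g f \<longleftrightarrow>
     (\<exists>h. (\<forall>x\<in>V. h x \<in> V) \<and> (\<forall>x\<in>V. \<forall>y\<in>V. g (f x) y = g x (h y)) \<and>
        (\<forall>x\<in>V. f (h x) = h (f x)))"

text \<open>The complexification of \<open>V\<close> is \<open>V \<times> V\<close>, where \<open>(u, v)\<close> stands for \<open>u + \<i> v\<close>; the complex
  linear extension of \<open>f\<close> is \<open>map_prod f f\<close>.\<close>

definition cscale :: "complex \<Rightarrow> 'a::real_vector \<times> 'a \<Rightarrow> 'a \<times> 'a" where
  "cscale c w = (Re c *\<^sub>R fst w - Im c *\<^sub>R snd w, Im c *\<^sub>R fst w + Re c *\<^sub>R snd w)"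

interpretation cplx: vector_space "cscale :: complex \<Rightarrow> 'a::real_vector \<times> 'a \<Rightarrow> 'a \<times> 'a"
  by unfold_locales (auto simp: cscale_def algebra_simps)

definition complex_spectrum :: "'a::real_vector set \<Rightarrow> ('a \<Rightarrow> 'a) \<Rightarrow> complex set" where
  "complex_spectrum V f =
     {c. \<exists>w \<in> V \<times> V. w \<noteq> 0 \<and> map_prod f f w = cscale c w}"

definition complex_diagonalizable :: "'a::real_vector set \<Rightarrow> ('a \<Rightarrow> 'a) \<Rightarrow> bool" where
  "complex_diagonalizable V f \<longleftrightarrow>
     (\<exists>B. cplx.independent B \<and> cplx.span B = V \<times> V \<and>
        (\<forall>w\<in>B. \<exists>c. map_prod f f w = cscale c w))"

end

theory Submission
  imports Defs "HOL-Computational_Algebra.Fundamental_Theorem_Algebra"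
begin

text \<open>Fix a Hermitian metric \<open>g\<close>, let \<open>U\<close> span the orthogonal complement of \<open>V = \<nn>\<^sub>1\<close> in the ideal
  \<open>\<nn>\<close>, put \<open>D = ad (J U)\<close>, and let \<open>\<tau>\<close> and \<open>u\<close> be the coordinates along \<open>J U\<close> and \<open>U\<close>. Then
  \<open>[x, y] = \<tau> x D y - \<tau> y D x\<close> and the torsion is \<open>H = u \<and> \<beta>\<close> for a 2-form \<open>\<beta>\<close>, which on \<open>V\<close> is
  \<open>g (J P \<cdot>, \<cdot>)\<close> with \<open>P = D + D\<^sup>*\<close>. If \<open>d H = \<alpha> \<and> H\<close>, closedness of \<open>\<alpha>\<close> forces \<open>\<alpha> = 0\<close> or
  \<open>\<beta> = 0\<close> on \<open>V\<close>, so the condition becomes \<open>P D + D\<^sup>* P = c P\<close> on \<open>V\<close> for some \<open>c\<close>. Evaluated on an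
  eigenvector \<open>x\<close> of the symmetric map \<open>P\<close> with eigenvalue \<open>p\<close> and paired with \<open>x\<close>, it gives
  \<open>p\<^sup>2 = c p\<close> and then \<open>P D x = D P x\<close>. Hence \<open>D\<close> is normal, and since \<open>P\<close> acts as \<open>2 Re \<lambda>\<close> on
  \<open>\<lambda>\<close>-eigenvectors, \<open>Re \<lambda> \<in> {0, c / 2}\<close>; the converse is read off in the same way. Finally, a
  diagonalizable \<open>D\<close> commuting with \<open>J\<close> is normal for any metric in which a \<open>J\<close>-complex basis of
  eigenvectors is unitary.\<close>

section \<open>Orthogonality and adjoints\<close>

locale inner_product_space =
  fixes g :: "'a::real_vector \<Rightarrow> 'a \<Rightarrow> real"
  assumes inner_product: "inner_product g"
    and finite_dim: "\<exists>B::'a set. finite B \<and> span B = UNIV"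
begin

lemma bilinear: "bilinear g"
  using inner_product by (simp add: inner_product_def)

lemma commute: "g x y = g y x"
  using inner_product by (simp add: inner_product_def)

lemma linear_left: "linear (\<lambda>x. g x y)" and linear_right: "linear (g x)"
  using bilinear by (simp_all add: bilinear_def)

lemmas add_left = linear_add[OF linear_left] and add_right = linear_add[OF linear_right]
  and diff_left = linear_diff[OF linear_left] and diff_right = linear_diff[OF linear_right]
  and minus_left = linear_neg[OF linear_left] and minus_right = linear_neg[OF linear_right]
  and scale_left = linear_scale[OF linear_left] and scale_right = linear_scale[OF linear_right]
  and zero_left = linear_0[OF linear_left] and zero_right = linear_0[OF linear_right]
  and sum_left = linear_sum[OF linear_left] and sum_right = linear_sum[OF linear_right]

lemmas inner_simps = add_left add_right diff_left diff_right minus_left minus_right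
  scale_left scale_right zero_left zero_right

lemma nonneg: "g x x \<ge> 0"
  using inner_product by (cases "x = 0") (auto simp: inner_product_def zero_left less_imp_le)

lemma pos: "x \<noteq> 0 \<Longrightarrow> g x x > 0"
  using inner_product by (simp add: inner_product_def)

lemma eq_zero_iff: "g x x = 0 \<longleftrightarrow> x = 0"
  using pos[of x] by (cases "x = 0") (auto simp: zero_left)

lemma eqI:
  assumes "subspace V" "x \<in> V" "y \<in> V" "\<And>z. z \<in> V \<Longrightarrow> g x z = g y z"
  shows "x = y"
proof -
  have "g (x - y) (x - y) = 0"
    using assms(4)[of "x - y"] assms(1-3) by (simp add: subspace_diff diff_left)
  then show ?thesis by (simp add: eq_zero_iff)
qed

lemma orthonormal_expansion:
  assumes "finite B" "\<And>b c. b \<in> B \<Longrightarrow> c \<in> B \<Longrightarrow> g b c = (if b = c then 1 else 0)" "x \<in> span B"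
  shows "(\<Sum>b\<in>B. g x b *\<^sub>R b) = x"
  using assms(3)
proof (induction rule: span_induct_alt)
  case base
  show ?case by (simp add: zero_left)
next
  case (step c x y)
  have "(\<Sum>b\<in>B. g x b *\<^sub>R b) = (\<Sum>b\<in>B. if b = x then b else 0)"
    using step assms(2) by (intro sum.cong) auto
  also have "\<dots> = x" using step assms(1) by simp
  finally have "(\<Sum>b\<in>B. g x b *\<^sub>R b) = x" .
  then show ?case
    using step by (simp add: inner_simps scaleR_add_left sum.distrib flip: scaleR_scaleR scaleR_sum_right)
qed

text \<open>The residue of \<open>x\<close> after projection onto the span found so far is
  normalised and added, or skipped when it vanishes, so \<open>A\<close> may be dependent.\<close>

lemma gram_schmidt:
  assumes "finite A"
  shows "\<exists>B. finite B \<and> span B = span A \<and> (\<forall>b\<in>B. \<forall>c\<in>B. g b c = (if b = c then 1 else 0))"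
  using assms
proof (induction rule: finite_induct)
  case empty
  show ?case by (intro exI[of _ "{}"]) auto
next
  case (insert x A)
  then obtain B where B: "finite B" "span B = span A"
    "\<And>b c. b \<in> B \<Longrightarrow> c \<in> B \<Longrightarrow> g b c = (if b = c then 1 else 0)"
    by blast
  define p where "p = (\<Sum>b\<in>B. g x b *\<^sub>R b)"
  have p: "p \<in> span B" by (auto simp: p_def intro: span_sum span_scale span_base)
  have orth: "g (x - p) c = 0" if "c \<in> B" for c
  proof -
    have "g p c = (\<Sum>b\<in>B. if b = c then g x b else 0)"
      using that B(3) by (auto simp: p_def sum_left scale_left intro!: sum.cong)
    then show ?thesis using that B(1) by (simp add: diff_left)
  qed
  show ?case
  proof (cases "x = p")
    case True
    then have "span (insert x A) = span A"
      using p B(2) by (simp add: span_redundant)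
    then show ?thesis using B by auto
  next
    case False
    define y where "y = (1 / sqrt (g (x - p) (x - p))) *\<^sub>R (x - p)"
    have q: "g (x - p) (x - p) > 0" using False by (intro pos) auto
    then have yy: "g y y = 1"
      by (simp add: y_def scale_left scale_right flip: power2_eq_square)
    have yB: "g y c = 0" "g c y = 0" if "c \<in> B" for c
      using orth[OF that] commute[of c "x - p"] by (auto simp: y_def scale_left scale_right)
    have x: "x = sqrt (g (x - p) (x - p)) *\<^sub>R y + p"
      using q by (simp add: y_def)
    have "x \<in> span (insert y B)"
      using p by (subst x, intro span_add span_scale) (auto intro: span_base span_mono[THEN subsetD])
    moreover have "A \<subseteq> span (insert y B)" "B \<subseteq> span (insert x A)"
      using B(2) span_superset[of A] span_superset[of B] span_mono[of A "insert x A"]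
        span_mono[of B "insert y B"] by blast+
    moreover have "y \<in> span (insert x A)"
      using p B(2) span_mono[of A "insert x A"] unfolding y_def
      by (intro span_scale span_diff) (auto intro: span_base)
    ultimately have "span (insert y B) = span (insert x A)"
      by (subst span_eq) auto
    moreover have "y \<notin> B" using yy yB(1)[of y] by auto
    ultimately show ?thesis using B yy yB
      by (intro exI[of _ "insert y B"]) auto
  qed
qed


lemma orthonormal_basis:
  assumes "subspace V"
  obtains B where "finite B" "span B = V"
    "\<And>b c. b \<in> B \<Longrightarrow> c \<in> B \<Longrightarrow> g b c = (if b = c then 1 else 0)"
proof -
  obtain A where A: "A \<subseteq> V" "independent A" "V \<subseteq> span A"
    using maximal_independent_subset[of V] by blast
  obtain T :: "'a set" where T: "finite T" "span T = UNIV" using finite_dim by blast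
  have "finite A" using independent_span_bound[OF T(1) A(2)] T(2) by auto
  moreover have "span A = V" using A assms by (metis span_minimal subset_antisym)
  ultimately show ?thesis using gram_schmidt[of A] that by auto
qed

lemma orthogonal_projection:
  assumes "subspace V"
  obtains p where "p \<in> V" "\<And>v. v \<in> V \<Longrightarrow> g (x - p) v = 0"
proof -
  obtain B where B: "finite B" "span B = V"
    "\<And>b c. b \<in> B \<Longrightarrow> c \<in> B \<Longrightarrow> g b c = (if b = c then 1 else 0)"
    using orthonormal_basis[OF assms] by blast
  define p where "p = (\<Sum>b\<in>B. g x b *\<^sub>R b)"
  have "g (x - p) v = 0" if "v \<in> V" for v
  proof -
    have "g p v = (\<Sum>b\<in>B. g x b * g v b)"
      by (simp add: p_def sum_left scale_left commute[of v])
    also have "\<dots> = g x (\<Sum>b\<in>B. g v b *\<^sub>R b)"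
      by (simp add: sum_right scale_right mult.commute)
    also have "\<dots> = g x v" using orthonormal_expansion[OF B(1,3)] that B(2) by simp
    finally show ?thesis by (simp add: diff_left)
  qed
  moreover have "p \<in> V" using B(2) by (auto simp: p_def intro: span_sum span_scale span_base)
  ultimately show ?thesis using that by blast
qed

text \<open>The adjoint of the restriction of \<open>f\<close> to \<open>V\<close> is expanded in an
  orthonormal basis of \<open>V\<close>; this makes \<open>h\<close> linear on the whole
  space.\<close>

lemma adjoint_exists:
  assumes "subspace V" "linear f"
  obtains h where "linear h" "range h \<subseteq> V" "\<And>x y. x \<in> V \<Longrightarrow> g (f x) y = g x (h y)"
proof -
  obtain B where B: "finite B" "span B = V"
    "\<And>b c. b \<in> B \<Longrightarrow> c \<in> B \<Longrightarrow> g b c = (if b = c then 1 else 0)"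
    using orthonormal_basis[OF assms(1)] by blast
  define h where "h y = (\<Sum>b\<in>B. g (f b) y *\<^sub>R b)" for y
  have "linear h"
    by (auto simp: h_def inner_simps scaleR_add_left sum.distrib scaleR_sum_right intro!: linearI)
  moreover have "range h \<subseteq> V"
    using B(2) by (auto simp: h_def intro: span_sum span_scale span_base)
  moreover have "g (f x) y = g x (h y)" if "x \<in> V" for x y
  proof -
    have "g (f x) y = g (f (\<Sum>b\<in>B. g x b *\<^sub>R b)) y"
      using orthonormal_expansion[OF B(1,3)] that B(2) by simp
    also have "\<dots> = (\<Sum>b\<in>B. g x b * g (f b) y)"
      by (simp add: linear_sum[OF assms(2)] linear_scale[OF assms(2)] sum_left scale_left)
    also have "\<dots> = g x (h y)"
      by (simp add: h_def sum_right scale_right mult.commute)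
    finally show ?thesis .
  qed
  ultimately show ?thesis using that by blast
qed

text \<open>Riesz vector of a functional on \<open>V\<close>. It turns the twisting 1-form into a
  vector to which \<open>D\<close> and \<open>J\<close> apply.\<close>

lemma functional_representation:
  assumes "subspace V" "linear \<phi>"
  obtains p where "p \<in> V" "\<And>x. x \<in> V \<Longrightarrow> \<phi> x = g p x"
proof -
  obtain B where B: "finite B" "span B = V"
    "\<And>b c. b \<in> B \<Longrightarrow> c \<in> B \<Longrightarrow> g b c = (if b = c then 1 else 0)"
    using orthonormal_basis[OF assms(1)] by blast
  define p where "p = (\<Sum>b\<in>B. \<phi> b *\<^sub>R b)"
  have "\<phi> x = g p x" if "x \<in> V" for x
  proof -
    have "\<phi> x = \<phi> (\<Sum>b\<in>B. g x b *\<^sub>R b)"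
      using orthonormal_expansion[OF B(1,3)] that B(2) by simp
    also have "\<dots> = g p x"
      by (simp add: p_def linear_sum[OF assms(2)] linear_scale[OF assms(2)] sum_left scale_left
          commute[of x] mult.commute)
    finally show ?thesis .
  qed
  moreover have "p \<in> V" using B(2) by (auto simp: p_def intro: span_sum span_scale span_base)
  ultimately show ?thesis using that by blast
qed

end

section \<open>Diagonalization of normal maps\<close>

lemma subspace_complexification:
  assumes "subspace V"
  shows "cplx.subspace (V \<times> V)"
  using assms by (auto simp: cplx.subspace_def subspace_def cscale_def zero_prod_def subspace_diff)

lemma map_prod_add: "linear f \<Longrightarrow> map_prod f f (v + w) = map_prod f f v + map_prod f f w"
  and map_prod_diff: "linear f \<Longrightarrow> map_prod f f (v - w) = map_prod f f v - map_prod f f w"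
  and map_prod_cscale: "linear f \<Longrightarrow> map_prod f f (cscale c w) = cscale c (map_prod f f w)"
  by (auto simp: map_prod_def cscale_def linear_add linear_diff linear_scale split: prod.splits)

section \<open>Polynomials in the complexified map\<close>

definition poly_apply :: "('a::real_vector \<Rightarrow> 'a) \<Rightarrow> complex poly \<Rightarrow> 'a \<times> 'a \<Rightarrow> 'a \<times> 'a" where
  "poly_apply f p w = (\<Sum>i\<le>degree p. cscale (coeff p i) ((map_prod f f ^^ i) w))"

lemma poly_apply_altdef:
  assumes "degree p \<le> m"
  shows "poly_apply f p w = (\<Sum>i\<le>m. cscale (coeff p i) ((map_prod f f ^^ i) w))"
  unfolding poly_apply_def using assms
  by (intro sum.mono_neutral_left) (auto simp: coeff_eq_0)

lemma funpow_map_prod_diff_cscale: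
  fixes f :: "'a::real_vector \<Rightarrow> 'a"
  assumes "linear f"
  shows "(map_prod f f ^^ i) (v - cscale c w) = (map_prod f f ^^ i) v - cscale c ((map_prod f f ^^ i) w)"
proof (induction i)
  case (Suc i)
  then show ?case by (simp add: map_prod_diff[OF assms] map_prod_cscale[OF assms])
qed simp

text \<open>The coefficients of X * q are those of \<open>q\<close> shifted by one; one application
  of the map to \<open>w\<close> absorbs the shift.\<close>

lemma poly_apply_linear_factor:
  assumes "linear f"
  shows "poly_apply f ([:-r, 1:] * q) w = poly_apply f q (map_prod f f w - cscale r w)"
proof -
  let ?F = "map_prod f f" and ?m = "degree q"
  have "degree ([:-r, 1:] * q) \<le> Suc ?m"
    by (rule order.trans[OF degree_mult_le]) simp
  then have "poly_apply f ([:-r, 1:] * q) w =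
      (\<Sum>i\<le>Suc ?m. cscale (coeff (pCons 0 q) i - r * coeff q i) ((?F ^^ i) w))"
    by (simp add: poly_apply_altdef[of _ "Suc ?m"] algebra_simps)
  also have "\<dots> = (\<Sum>i\<le>Suc ?m. cscale (coeff (pCons 0 q) i) ((?F ^^ i) w))
      - (\<Sum>i\<le>Suc ?m. cscale (r * coeff q i) ((?F ^^ i) w))"
    by (simp only: cplx.scale_left_diff_distrib sum_subtractf)
  also have "(\<Sum>i\<le>Suc ?m. cscale (coeff (pCons 0 q) i) ((?F ^^ i) w))
      = (\<Sum>i\<le>?m. cscale (coeff q i) ((?F ^^ i) (?F w)))"
    by (subst sum.atMost_Suc_shift) (simp add: funpow_swap1)
  also have "(\<Sum>i\<le>Suc ?m. cscale (r * coeff q i) ((?F ^^ i) w))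
      = (\<Sum>i\<le>?m. cscale (coeff q i) (cscale r ((?F ^^ i) w)))"
    by (simp add: coeff_eq_0 mult.commute)
  finally show ?thesis
    by (simp add: poly_apply_def funpow_map_prod_diff_cscale[OF assms]
        cplx.scale_right_diff_distrib sum_subtractf)
qed

text \<open>The \<open>card B + 1\<close> vectors \<open>(f ^^ i) x\<close> satisfy a linear
  relation. The polynomial depends on \<open>x\<close>, as vectors are treated one at a
  time.\<close>

lemma annihilating_poly_exists:
  fixes f :: "'a::real_vector \<Rightarrow> 'a"
  assumes fd: "\<exists>B::'a set. finite B \<and> span B = UNIV" and f: "linear f"
  obtains p where "p \<noteq> 0" "poly_apply f p (x, 0) = 0"
proof -
  obtain B :: "'a set" where B: "finite B" "span B = UNIV" using fd by blast
  define m where "m = card B"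
  have "\<exists>c. (\<exists>i\<le>m. c i \<noteq> 0) \<and> (\<Sum>i\<le>m. c i *\<^sub>R (f ^^ i) x) = 0"
  proof (cases "inj_on (\<lambda>i. (f ^^ i) x) {..m}")
    case True
    let ?S = "(\<lambda>i. (f ^^ i) x) ` {..m}"
    have "card ?S = Suc m" using card_image[OF True] by simp
    then have "dependent ?S"
      using independent_span_bound[OF B(1), of ?S] B(2) m_def by fastforce
    then obtain u v where u: "v \<in> ?S" "u v \<noteq> 0" "(\<Sum>v\<in>?S. u v *\<^sub>R v) = 0"
      using dependent_finite[of ?S] by blast
    then show ?thesis
      using True by (intro exI[of _ "\<lambda>i. u ((f ^^ i) x)"]) (auto simp: sum.reindex)
  next
    case False
    then obtain i j where ij: "i \<le> m" "j \<le> m" "i \<noteq> j" "(f ^^ i) x = (f ^^ j) x"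
      by (auto simp: inj_on_def)
    \<comment> \<open>Two equal iterates are a single element of the image set, so their relation,
      with coefficients 1 and -1, is written down directly.\<close>
    define c where "c k = (if k = i then 1 else 0) - (if k = j then 1 else 0 :: real)" for k
    have "(\<Sum>k\<le>m. c k *\<^sub>R (f ^^ k) x) =
        (\<Sum>k\<le>m. if k = i then (f ^^ k) x else 0) - (\<Sum>k\<le>m. if k = j then (f ^^ k) x else 0)"
      by (subst sum_subtractf[symmetric], rule sum.cong) (auto simp: c_def)
    also have "\<dots> = 0" using ij by simp
    finally show ?thesis using ij by (intro exI[of _ c]) (auto simp: c_def)
  qed
  then obtain c i where c: "i \<le> m" "c i \<noteq> 0" "(\<Sum>i\<le>m. c i *\<^sub>R (f ^^ i) x) = 0"
    by blast
  define p where "p = (\<Sum>i\<le>m. monom (complex_of_real (c i)) i)"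
  have co: "coeff p k = (if k \<le> m then complex_of_real (c k) else 0)" for k
    by (auto simp: p_def coeff_sum)
  have "degree p \<le> m" by (rule degree_le) (simp add: co)
  have 1: "(map_prod f f ^^ k) (x, 0) = ((f ^^ k) x, 0)" for k
    by (induction k) (simp_all add: linear_0[OF f])
  have "poly_apply f p (x, 0) = (\<Sum>k\<le>m. (c k *\<^sub>R (f ^^ k) x, 0))"
    by (simp add: poly_apply_altdef[OF \<open>degree p \<le> m\<close>] co 1 cscale_def)
  also have "\<dots> = 0" by (simp add: c(3) prod_eq_iff fst_sum snd_sum)
  finally have "poly_apply f p (x, 0) = 0" .
  moreover have "p \<noteq> 0" using c co[of i] by auto
  ultimately show ?thesis using that by blast
qed

text \<open>The kernel condition says that no generalised eigenvector of order two exists; it lets one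
  peel off the linear factors of an annihilating polynomial one at a time.\<close>

lemma span_eigenvectors_eq:
  fixes f :: "'a::real_vector \<Rightarrow> 'a"
  assumes fd: "\<exists>B::'a set. finite B \<and> span B = UNIV" and f: "linear f"
    and V: "subspace V" "f ` V \<subseteq> V"
    and ker: "\<And>r v. v \<in> V \<times> V \<Longrightarrow>
      map_prod f f (map_prod f f v - cscale r v) = cscale r (map_prod f f v - cscale r v) \<Longrightarrow>
      map_prod f f v = cscale r v"
  shows "cplx.span {w \<in> V \<times> V. \<exists>c. map_prod f f w = cscale c w} = V \<times> V" (is "cplx.span ?S = _")
proof -
  let ?F = "map_prod f f"
  note VV = subspace_complexification[OF V(1)]
  have FV: "?F w \<in> V \<times> V" if "w \<in> V \<times> V" for w
    using V(2) that by (cases w) (auto simp: image_subset_iff)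
  \<comment> \<open>On the span of eigenvectors, \<open>?F - r\<close> is invertible on the part
    with eigenvalues other than \<open>r\<close>, which supplies \<open>z\<close>; the part with
    eigenvalue \<open>r\<close> is collected in \<open>k\<close>.\<close>
  have split: "\<exists>z\<in>cplx.span ?S. \<exists>k\<in>V \<times> V. ?F k = cscale r k \<and> w = ?F z - cscale r z + k"
    if "w \<in> cplx.span ?S" for w r
    using that
  proof (induction rule: cplx.span_induct_alt)
    case base
    have "?F 0 = 0" using map_prod_diff[OF f, of 0 0] by simp
    then show ?case
      using cplx.subspace_0[OF VV]
      by (intro bexI[of _ 0]) (simp_all add: cplx.span_zero)
  next
    case (step c x y)
    then obtain z k l where IH: "z \<in> cplx.span ?S" "k \<in> V \<times> V" "?F k = cscale r k"
      "y = ?F z - cscale r z + k" and x: "x \<in> V \<times> V" "?F x = cscale l x"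
      by blast
    show ?case
    proof (cases "l = r")
      case True
      have "?F (cscale c x + k) = cscale r (cscale c x + k)"
        by (simp add: map_prod_add[OF f] map_prod_cscale[OF f] IH x True
            cplx.scale_right_distrib mult.commute)
      moreover have "cscale c x + k \<in> V \<times> V"
        using IH x by (intro cplx.subspace_add[OF VV] cplx.subspace_scale[OF VV])
      ultimately show ?thesis using IH
        by (intro bexI[of _ z] bexI[of _ "cscale c x + k"]) auto
    next
      case False
      define d where "d = c / (l - r)"
      have "d * l - r * d = d * (l - r)" by (simp add: algebra_simps)
      also have "\<dots> = c" using False by (simp add: d_def)
      finally have "d * l - r * d = c" .
      then have "?F (cscale d x) - cscale r (cscale d x) = cscale c x"
        by (simp add: map_prod_cscale[OF f] x flip: cplx.scale_left_diff_distrib)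
      then have "cscale c x + y = ?F (cscale d x + z) - cscale r (cscale d x + z) + k"
        by (simp add: IH(4) map_prod_add[OF f] cplx.scale_right_distrib)
      moreover have "cscale d x + z \<in> cplx.span ?S"
        using step IH by (intro cplx.span_add cplx.span_scale) (auto intro: cplx.span_base)
      ultimately show ?thesis using IH by blast
    qed
  qed
  have sub: "cplx.span ?S \<subseteq> V \<times> V"
    by (rule cplx.span_minimal[OF _ VV]) auto
  \<comment> \<open>If p = (X - r) q, then \<open>q\<close> annihilates
    \<open>?F w - cscale r w\<close>, which by induction lies in the span. Subtracting the
    \<open>z\<close> of \<open>split\<close> from \<open>w\<close> leaves a vector on which
    \<open>?F - r\<close> takes the value \<open>k\<close>, and \<open>ker\<close> shows that it is
    an eigenvector.\<close>
  have main: "w \<in> cplx.span ?S" if "w \<in> V \<times> V" "p \<noteq> 0" "poly_apply f p w = 0" for w p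
    using that
  proof (induction "degree p" arbitrary: p w)
    case 0
    then obtain a where "p = [:a:]" by (metis degree_eq_zeroE)
    then have "w = 0" using 0 by (simp add: poly_apply_def)
    then show ?case by (simp add: cplx.span_zero)
  next
    case (Suc m)
    then have "\<not> constant (poly p)" by (simp add: constant_degree)
    then obtain r where "poly p r = 0" using fundamental_theorem_of_algebra by blast
    then obtain q where q: "p = [:-r, 1:] * q" using poly_eq_0_iff_dvd by blast
    with Suc have "q \<noteq> 0" by auto
    then have "degree p = Suc (degree q)" by (simp add: q degree_mult_eq del: mult_pCons_left)
    moreover have "?F w - cscale r w \<in> V \<times> V"
      using Suc by (intro cplx.subspace_diff[OF VV] cplx.subspace_scale[OF VV] FV)
    ultimately have "?F w - cscale r w \<in> cplx.span ?S"
      using Suc q \<open>q \<noteq> 0\<close> by (intro Suc(1)[of q]) (simp_all add: poly_apply_linear_factor[OF f] del: mult_pCons_left)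
    then obtain z k where z: "z \<in> cplx.span ?S" "?F k = cscale r k"
      "?F w - cscale r w = ?F z - cscale r z + k"
      using split by blast
    have wz: "w - z \<in> V \<times> V" using z sub Suc by (intro cplx.subspace_diff[OF VV]) auto
    have k: "?F (w - z) - cscale r (w - z) = k"
      using z(3) by (simp add: map_prod_diff[OF f] cplx.scale_right_diff_distrib algebra_simps)
    have "?F (w - z) = cscale r (w - z)"
      by (rule ker[OF wz]) (simp add: k z(2))
    then have "w - z \<in> cplx.span ?S" using wz by (intro cplx.span_base) auto
    then show ?case using cplx.span_add[OF _ z(1)] by fastforce
  qed
  have "(x, 0) \<in> cplx.span ?S" if "x \<in> V" for x
    using annihilating_poly_exists[OF fd f, of x] main[of "(x, 0)"] that subspace_0[OF V(1)]
    by (metis mem_Times_iff fst_conv snd_conv)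
  then have "(x, 0) + cscale \<i> (y, 0) \<in> cplx.span ?S" if "x \<in> V" "y \<in> V" for x y
    using that by (intro cplx.span_add cplx.span_scale)
  then have "V \<times> V \<subseteq> cplx.span ?S" by (auto simp: cscale_def)
  with sub show ?thesis by blast
qed

lemma complex_diagonalizableI:
  assumes "cplx.span {w \<in> V \<times> V. \<exists>c. map_prod f f w = cscale c w} = V \<times> V"
  shows "complex_diagonalizable V f"
proof -
  let ?S = "{w \<in> V \<times> V. \<exists>c. map_prod f f w = cscale c w}"
  obtain B where B: "B \<subseteq> ?S" "cplx.independent B" "?S \<subseteq> cplx.span B"
    using cplx.maximal_independent_subset[of ?S] by blast
  have "cplx.span B = V \<times> V"
    using cplx.span_mono[OF B(1)] cplx.span_minimal[OF B(3) cplx.subspace_span] assms by auto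
  with B show ?thesis unfolding complex_diagonalizable_def by blast
qed

text \<open>Eigenvectors span, so a complex subspace containing them is everything. The premise
  \<open>w \<noteq> 0\<close> puts their eigenvalues into the spectrum.\<close>

lemma complex_diagonalizable_induct:
  assumes "complex_diagonalizable V f" "w \<in> V \<times> V" "cplx.subspace {w. P w}"
    and "\<And>w c. w \<in> V \<times> V \<Longrightarrow> w \<noteq> 0 \<Longrightarrow> map_prod f f w = cscale c w \<Longrightarrow> P w"
  shows "P w"
proof -
  obtain B where B: "cplx.independent B" "cplx.span B = V \<times> V"
    "\<And>w. w \<in> B \<Longrightarrow> \<exists>c. map_prod f f w = cscale c w"
    using assms(1) unfolding complex_diagonalizable_def by blast
  have "P b" if "b \<in> B" for b
  proof (cases "b = 0")
    case True then show ?thesis using cplx.subspace_0[OF assms(3)] by simp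
  next
    case False then show ?thesis using B assms(4) that cplx.span_base by metis
  qed
  then show ?thesis
    using cplx.span_induct[of w B P] assms(2,3) B(2) by auto
qed

section \<open>Normal endomorphisms\<close>

context inner_product_space
begin

text \<open>As \<open>h\<close> commutes with \<open>f\<close>, the vector (h - cnj r) w is again an
  \<open>r\<close>-eigenvector of \<open>f\<close>; moving \<open>h\<close> across the inner product
  then shows that its norm is zero.\<close>

lemma normal_adjoint_kernel:
  assumes V: "subspace V" "f ` V \<subseteq> V" "h ` V \<subseteq> V" "linear f" "linear h"
    and adj: "\<And>x y. x \<in> V \<Longrightarrow> y \<in> V \<Longrightarrow> g (f x) y = g x (h y)"
    and com: "\<And>x. x \<in> V \<Longrightarrow> f (h x) = h (f x)"
    and w: "w \<in> V \<times> V" "map_prod f f w = cscale r w"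
  shows "map_prod h h w = cscale (cnj r) w"
proof -
  obtain x y where w': "w = (x, y)" "x \<in> V" "y \<in> V" using w by auto
  define a b where "a = Re r" "b = Im r"
  have f: "f x = a *\<^sub>R x - b *\<^sub>R y" "f y = b *\<^sub>R x + a *\<^sub>R y"
    using w(2) by (auto simp: w' cscale_def a_b_def)
  \<comment> \<open>Real and imaginary parts of (h - cnj r) w.\<close>
  define p q where "p = h x - (a *\<^sub>R x + b *\<^sub>R y)" and "q = h y - (a *\<^sub>R y - b *\<^sub>R x)"
  have pq: "p \<in> V" "q \<in> V"
    using V w' by (auto simp: p_def q_def subspace_diff subspace_add subspace_scale)
  have adj': "g (f u) v = g u (h v)" "g (h v) u = g v (f u)" if "u \<in> V" "v \<in> V" for u v
    using adj that commute by metis+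
  have fp: "f p = a *\<^sub>R p - b *\<^sub>R q" and fq: "f q = b *\<^sub>R p + a *\<^sub>R q"
    using com[of x] com[of y] w'
    by (auto simp: p_def q_def f linear_add[OF V(4)] linear_diff[OF V(4)] linear_scale[OF V(4)]
        linear_add[OF V(5)] linear_diff[OF V(5)] linear_scale[OF V(5)] algebra_simps)
  have hp: "h x = p + (a *\<^sub>R x + b *\<^sub>R y)" and hq: "h y = q + (a *\<^sub>R y - b *\<^sub>R x)"
    by (simp_all add: p_def q_def)
  have "g p p + g q q = g p (h x) - a * g p x - b * g p y + g q (h y) - a * g q y + b * g q x"
    by (simp add: hp hq inner_simps algebra_simps)
  moreover have "g p (h x) = g (f p) x" "g q (h y) = g (f q) y" using adj pq w' by auto
  ultimately have "g p p + g q q = 0" by (simp add: fp fq inner_simps)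
  then have "p = 0" "q = 0" by (simp_all add: add_nonneg_eq_0_iff nonneg eq_zero_iff)
  then show ?thesis by (simp add: w' p_def q_def cscale_def a_b_def)
qed

text \<open>If w = (f - r) v satisfies f w = r w, then h w = cnj r w by
  \<open>normal_adjoint_kernel\<close>, so w is orthogonal to (f - r) v = w. This is the kernel
  condition of \<open>span_eigenvectors_eq\<close>.\<close>

lemma normal_complex_diagonalizable:
  assumes V: "subspace V" "f ` V \<subseteq> V" "h ` V \<subseteq> V" "linear f" "linear h"
    and adj: "\<And>x y. x \<in> V \<Longrightarrow> y \<in> V \<Longrightarrow> g (f x) y = g x (h y)"
    and com: "\<And>x. x \<in> V \<Longrightarrow> f (h x) = h (f x)"
  shows "complex_diagonalizable V f"
proof (intro complex_diagonalizableI span_eigenvectors_eq finite_dim V)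
  fix r v assume v: "v \<in> V \<times> V"
    and eq: "map_prod f f (map_prod f f v - cscale r v) = cscale r (map_prod f f v - cscale r v)"
  let ?w = "map_prod f f v - cscale r v"
  note VV = subspace_complexification[OF V(1)]
  have "map_prod f f v \<in> V \<times> V" using V(2) v by (cases v) (auto simp: image_subset_iff)
  then have w: "?w \<in> V \<times> V" using v by (intro cplx.subspace_diff[OF VV] cplx.subspace_scale[OF VV])
  then have hw: "map_prod h h ?w = cscale (cnj r) ?w"
    using normal_adjoint_kernel[OF assms w eq] by blast
  obtain x y where xy: "v = (x, y)" "x \<in> V" "y \<in> V" using v by auto
  obtain p q where pq: "?w = (p, q)" "p \<in> V" "q \<in> V" using w by (metis mem_Sigma_iff surj_pair)
  have p: "p = f x - Re r *\<^sub>R x + Im r *\<^sub>R y" and q: "q = f y - Im r *\<^sub>R x - Re r *\<^sub>R y"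
    using pq(1) by (auto simp: xy cscale_def)
  have fxy: "f x = p + Re r *\<^sub>R x - Im r *\<^sub>R y" "f y = q + Im r *\<^sub>R x + Re r *\<^sub>R y"
    by (simp_all add: p q)
  have h: "h p = Re r *\<^sub>R p + Im r *\<^sub>R q" "h q = Re r *\<^sub>R q - Im r *\<^sub>R p"
    using hw unfolding pq(1) by (auto simp: cscale_def)
  have "g p p + g q q = g (f x) p - Re r * g x p + Im r * g y p + g (f y) q - Im r * g x q - Re r * g y q"
    by (simp add: fxy inner_simps algebra_simps)
  moreover have "g (f x) p = g x (h p)" "g (f y) q = g y (h q)" using adj xy pq by auto
  ultimately have "g p p + g q q = 0" by (simp add: h inner_simps)
  then have "p = 0" "q = 0" by (simp_all add: add_nonneg_eq_0_iff nonneg eq_zero_iff)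
  then show "map_prod f f v = cscale r v" using pq(1) by (simp flip: zero_prod_def)
qed

end

section \<open>The torsion of a Hermitian almost abelian Lie algebra\<close>

text \<open>The bracket data of an almost abelian Lie algebra relative to an orthogonal splitting
  \<open>\<langle>J U\<rangle> \<oplus> \<langle>U\<rangle> \<oplus> V\<close>, where \<open>V\<close> is \<open>\<nn>\<^sub>1\<close> and \<open>\<langle>U\<rangle> \<oplus> V\<close> is the ideal. The vector \<open>U\<close> is not
  normalised, so that \<open>J U\<close> can be chosen to act on \<open>V\<close> exactly as \<open>e\<^sub>2\<^sub>n\<close> does.\<close>

locale hermitian_splitting = inner_product_space g
  for g :: "'a::real_vector \<Rightarrow> 'a \<Rightarrow> real" +
  fixes br :: "'a \<Rightarrow> 'a \<Rightarrow> 'a" and J :: "'a \<Rightarrow> 'a" and V :: "'a set" and U :: 'a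
    and a :: real and v0 :: 'a
  assumes bilinear_br: "bilinear br" and br_self: "br x x = 0"
    and linear_J: "linear J" and J_J: "J (J x) = - x" and g_J: "g (J x) (J y) = g x y"
    and V: "subspace V" "v \<in> V \<Longrightarrow> J v \<in> V"
    and br_V: "v \<in> V \<Longrightarrow> w \<in> V \<Longrightarrow> br v w = 0" "v \<in> V \<Longrightarrow> br U v = 0"
    and ad_V: "v \<in> V \<Longrightarrow> br (J U) v \<in> V" "v \<in> V \<Longrightarrow> br (J U) (J v) = J (br (J U) v)"
    and ad_U: "br (J U) U = a *\<^sub>R U + v0" "v0 \<in> V"
    and U: "U \<noteq> 0" "v \<in> V \<Longrightarrow> g U v = 0"
    and splitting: "\<exists>s t. \<exists>v\<in>V. x = s *\<^sub>R J U + t *\<^sub>R U + v"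
begin

definition D :: "'a \<Rightarrow> 'a" where "D = br (J U)"
text \<open>Dividing by \<open>g U U\<close> makes \<open>u\<close> and \<open>\<tau>\<close> dual
  to \<open>U\<close> and \<open>J U\<close>, since \<open>U\<close> is not normalised.\<close>

definition u :: "'a \<Rightarrow> real" where "u x = g U x / g U U"
definition \<tau> :: "'a \<Rightarrow> real" where "\<tau> x = g (J U) x / g U U"
definition \<beta> :: "'a \<Rightarrow> 'a \<Rightarrow> real" where "\<beta> y z = g (D (J y)) z - g (D (J z)) y"

lemma linear_D: "linear D"
  using bilinear_br by (simp add: D_def bilinear_def)

lemmas D_simps = linear_add[OF linear_D] linear_diff[OF linear_D] linear_scale[OF linear_D]
  linear_neg[OF linear_D] linear_0[OF linear_D]
lemmas J_simps = linear_add[OF linear_J] linear_diff[OF linear_J] linear_scale[OF linear_J]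
  linear_neg[OF linear_J] linear_0[OF linear_J] J_J

lemma D_V: "v \<in> V \<Longrightarrow> D v \<in> V" and D_J: "v \<in> V \<Longrightarrow> D (J v) = J (D v)"
  and D_U: "D U = a *\<^sub>R U + v0" and D_JU: "D (J U) = 0"
  by (simp_all add: D_def ad_V ad_U br_self)

lemma br_swap: "br x y = - br y x"
proof -
  have "br (x + y) (x + y) = br x y + br y x"
    by (simp add: bilinear_ladd[OF bilinear_br] bilinear_radd[OF bilinear_br] br_self[of x] br_self[of y])
  then have "br x y + br y x = 0" by (simp only: br_self)
  then show ?thesis by (simp only: eq_neg_iff_add_eq_0)
qed

lemma g_J_left: "g (J x) y = - g x (J y)"
  using g_J[of x "- J y"] by (simp add: J_simps inner_simps)

lemma g_J_self: "g x (J x) = 0"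
  using g_J_left[of x x] commute[of x "J x"] by simp

lemma u_simps: "u (x + y) = u x + u y" "u (x - y) = u x - u y" "u (c *\<^sub>R x) = c * u x"
    "u (- x) = - u x" "u 0 = 0"
  and \<tau>_simps: "\<tau> (x + y) = \<tau> x + \<tau> y" "\<tau> (x - y) = \<tau> x - \<tau> y" "\<tau> (c *\<^sub>R x) = c * \<tau> x"
    "\<tau> (- x) = - \<tau> x" "\<tau> 0 = 0"
  by (simp_all add: u_def \<tau>_def inner_simps add_divide_distrib diff_divide_distrib)

lemma \<tau>_J: "\<tau> (J x) = u x"
  by (simp add: \<tau>_def u_def g_J)

lemma u_V: "v \<in> V \<Longrightarrow> u v = 0" and \<tau>_V: "v \<in> V \<Longrightarrow> \<tau> v = 0"
  and u_U: "u U = 1" and \<tau>_JU: "\<tau> (J U) = 1" and u_JU: "u (J U) = 0" and \<tau>_U: "\<tau> U = 0"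
  using U(1) g_J_self[of U] commute[of U "J U"]
  by (simp_all add: u_def \<tau>_def U(2) V(2) g_J_left[of U v] g_J eq_zero_iff)

lemma splitting':
  obtains v where "v \<in> V" "x = \<tau> x *\<^sub>R J U + u x *\<^sub>R U + v"
proof -
  obtain s t v where v: "v \<in> V" "x = s *\<^sub>R J U + t *\<^sub>R U + v" using splitting by blast
  have "\<tau> x = s" "u x = t"
    by (simp_all add: v u_simps \<tau>_simps u_V \<tau>_V u_U \<tau>_JU u_JU \<tau>_U)
  then have "x = \<tau> x *\<^sub>R J U + u x *\<^sub>R U + v" using v(2) by (simp only:)
  then show ?thesis by (rule that[OF v(1)])
qed

lemma u_D: "u (D x) = a * u x" and \<tau>_D: "\<tau> (D x) = 0"
proof -
  obtain v where v: "v \<in> V" "x = \<tau> x *\<^sub>R J U + u x *\<^sub>R U + v" by (rule splitting')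
  have "D x = u x *\<^sub>R (a *\<^sub>R U + v0) + D v"
    by (subst v(2)) (simp add: D_simps D_JU D_U)
  then show "u (D x) = a * u x" "\<tau> (D x) = 0"
    using D_V[OF v(1)] ad_U by (simp_all add: u_simps \<tau>_simps u_V \<tau>_V u_U \<tau>_U)
qed

text \<open>The ideal spanned by \<open>U\<close> and \<open>V\<close> is abelian, so only the
  \<open>J U\<close>-coordinates act; \<open>D\<close> kills \<open>J U\<close>, so it may be
  applied to the full vectors.\<close>

lemma br_eq: "br x y = \<tau> x *\<^sub>R D y - \<tau> y *\<^sub>R D x"
proof -
  obtain v where v: "v \<in> V" "x = \<tau> x *\<^sub>R J U + u x *\<^sub>R U + v" by (rule splitting')
  obtain w where w: "w \<in> V" "y = \<tau> y *\<^sub>R J U + u y *\<^sub>R U + w" by (rule splitting')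
  define m m' where "m = u x *\<^sub>R U + v" and "m' = u y *\<^sub>R U + w"
  have x: "x = \<tau> x *\<^sub>R J U + m" and y: "y = \<tau> y *\<^sub>R J U + m'"
    using v(2) w(2) by (simp_all add: m_def m'_def add.assoc)
  have "br v U = 0" using br_swap[of v U] br_V(2)[OF v(1)] by simp
  then have "br m m' = 0"
    by (simp add: m_def m'_def br_V v(1) w(1) br_self
        bilinear_ladd[OF bilinear_br] bilinear_radd[OF bilinear_br]
        bilinear_lmul[OF bilinear_br] bilinear_rmul[OF bilinear_br])
  moreover have "br m (J U) = - D m" using br_swap[of m "J U"] by (simp add: D_def)
  \<comment> \<open>The coefficients stay free until the end, because rewriting \<open>x\<close> by
    its decomposition would also affect the \<open>x\<close> inside \<open>\<tau> x\<close>.\<close>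
  ultimately have *: "br (s *\<^sub>R J U + m) (s' *\<^sub>R J U + m') = s *\<^sub>R D m' - s' *\<^sub>R D m" for s s'
    by (simp add: bilinear_ladd[OF bilinear_br] bilinear_radd[OF bilinear_br]
        bilinear_lmul[OF bilinear_br] bilinear_rmul[OF bilinear_br] br_self D_def)
  have "D (s *\<^sub>R J U + m) = D m" "D (s *\<^sub>R J U + m') = D m'" for s
    by (simp_all add: D_simps D_JU)
  from this(1)[of "\<tau> x"] this(2)[of "\<tau> y"] have "D x = D m" "D y = D m'"
    unfolding x[symmetric] y[symmetric] .
  with *[of "\<tau> x" "\<tau> y"] show ?thesis
    unfolding x[symmetric] y[symmetric] by simp
qed

lemma \<beta>_simps: "\<beta> (x + y) z = \<beta> x z + \<beta> y z" "\<beta> z (x + y) = \<beta> z x + \<beta> z y"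
    "\<beta> (x - y) z = \<beta> x z - \<beta> y z" "\<beta> z (x - y) = \<beta> z x - \<beta> z y"
    "\<beta> (c *\<^sub>R x) z = c * \<beta> x z" "\<beta> z (c *\<^sub>R x) = c * \<beta> z x"
    "\<beta> 0 z = 0" "\<beta> z 0 = 0"
  by (simp_all add: \<beta>_def inner_simps D_simps J_simps algebra_simps)

lemma \<beta>_swap: "\<beta> y x = - \<beta> x y"
  by (simp add: \<beta>_def)

text \<open>At J x, J y, J z the outer \<open>J\<close> in the fundamental form cancels by
  \<open>g_J\<close>, while \<open>br_eq\<close> produces \<open>\<tau> (J x)\<close>, which is
  \<open>u x\<close>.\<close>

lemma torsion: "bismut_torsion br J g [x, y, z] = u x * \<beta> y z + u y * \<beta> z x + u z * \<beta> x y"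
  unfolding bismut_torsion_def list.map ce_d_2 fundamental_form_def
  by (simp add: g_J br_eq \<tau>_J \<beta>_def inner_simps algebra_simps)

section \<open>The twisted SKT condition as an identity for \<open>\<beta>\<close> on
  \<open>V\<close>\<close>

lemma \<beta>_J: "x \<in> V \<Longrightarrow> y \<in> V \<Longrightarrow> \<beta> (J x) (J y) = \<beta> x y"
  by (simp add: \<beta>_def J_simps D_J D_simps inner_simps g_J_left)

lemma twisted_SKT_imp:
  assumes "twisted_SKT br J g"
  shows "\<exists>c. \<forall>y\<in>V. \<forall>z\<in>V. \<beta> (D y) z + \<beta> y (D z) = c * \<beta> y z"
proof -
  obtain \<alpha> where \<alpha>: "linear \<alpha>" "\<And>x y. \<alpha> (br x y) = 0"
    "\<And>x y z w. ce_d br (bismut_torsion br J g) [x, y, z, w] =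
      wedge1 \<alpha> (bismut_torsion br J g) [x, y, z, w]"
    using assms by (auto simp: twisted_SKT_def ce_d_one_form)
  \<comment> \<open>The 4-form equation at (U, x, y, z) says that \<alpha> \<and> \<beta> vanishes
    on \<open>V\<close>; at (J U, U, y, z) it gives the action of \<open>D\<close> on
    \<beta>.\<close>
  have I: "\<alpha> x * \<beta> y z - \<alpha> y * \<beta> x z + \<alpha> z * \<beta> x y = 0" if "x \<in> V" "y \<in> V" "z \<in> V" for x y z
    using \<alpha>(3)[of U x y z] that \<beta>_swap[of x z]
    by (simp add: ce_d_3 wedge1_3 torsion br_eq u_V \<tau>_V \<tau>_U u_U u_simps \<beta>_simps)
  have II: "- (a * \<beta> y z + \<beta> (D y) z + \<beta> y (D z)) =
      \<alpha> (J U) * \<beta> y z + \<alpha> y * \<beta> z (J U) - \<alpha> z * \<beta> y (J U)" if "y \<in> V" "z \<in> V" for y z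
    using \<alpha>(3)[of "J U" U y z] that \<beta>_swap[of "D y" z] \<beta>_swap[of "D z" y]
    by (simp add: ce_d_3 wedge1_3 torsion br_eq u_V \<tau>_V \<tau>_U u_U \<tau>_JU u_JU u_D D_JU u_simps \<beta>_simps
        D_V algebra_simps)
  obtain p where p: "p \<in> V" "\<And>x. x \<in> V \<Longrightarrow> \<alpha> x = g p x"
    using functional_representation[OF V(1) \<alpha>(1)] by blast
  show ?thesis
  proof (cases "p = 0")
    case True
    then have "\<alpha> x = 0" if "x \<in> V" for x using p that by (simp add: inner_simps)
    with II have "\<beta> (D y) z + \<beta> y (D z) = (- a - \<alpha> (J U)) * \<beta> y z" if "y \<in> V" "z \<in> V" for y z
      using that by (fastforce simp: algebra_simps)
    then show ?thesis by blast
  next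
    case False
    then have gp: "g p p \<noteq> 0" by (simp add: eq_zero_iff)
    \<comment> \<open>Closedness makes \<open>D p\<close> orthogonal to \<open>p\<close>, and
      \<open>\<beta> p (J p)\<close> is twice \<open>g (D p) p\<close>. Then I kills
      \<open>\<beta> (J p)\<close> on \<open>V\<close>, \<open>\<beta>_J\<close> carries this over
      to \<open>\<beta> p\<close>, and I once more kills \<beta> on \<open>V\<close>.\<close>
    have "\<alpha> (D p) = 0" using \<alpha>(2) by (simp add: D_def)
    then have "g p (D p) = 0" using p D_V by simp
    then have "\<beta> p (J p) = 0"
      using p(1) commute[of p "D p"] by (simp add: \<beta>_def D_J J_J D_simps inner_simps g_J)
    then have "\<beta> (J p) y = 0" if "y \<in> V" for y
      using I[of p "J p" y] p that V(2) gp g_J_self by simp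
    then have "\<beta> p y = 0" if "y \<in> V" for y
      using \<beta>_J[of p y] p that V(2) by simp
    then have "\<beta> y z = 0" if "y \<in> V" "z \<in> V" for y z
      using I[of p y z] p that gp by simp
    then show ?thesis using D_V by simp
  qed
qed

text \<open>The twisting form is t \<tau>. With it, dH - \<alpha> \<and> H equals - \<tau> \<and> u
  \<and> \<gamma>, where \<gamma> is the defect of the assumed identity and vanishes on
  \<open>V\<close>.\<close>

lemma twisted_SKT_if:
  assumes "\<And>y z. y \<in> V \<Longrightarrow> z \<in> V \<Longrightarrow> \<beta> (D y) z + \<beta> y (D z) = c * \<beta> y z"
  shows "twisted_SKT br J g"
proof -
  \<comment> \<open>The value forced by the equation at (J U, U, y, z), where \<open>a\<close>
    enters through \<open>u_D\<close>.\<close>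
  define t where "t = - a - c"
  define \<gamma> where "\<gamma> y z = \<beta> (D y) z + \<beta> y (D z) + (a + t) * \<beta> y z" for y z
  have \<gamma>_V: "\<gamma> y z = 0" if "y \<in> V" "z \<in> V" for y z
    using assms[OF that] by (simp add: \<gamma>_def t_def algebra_simps)
  have \<gamma>_simps: "\<gamma> (x + y) z = \<gamma> x z + \<gamma> y z" "\<gamma> z (x + y) = \<gamma> z x + \<gamma> z y"
    "\<gamma> (r *\<^sub>R x) z = r * \<gamma> x z" "\<gamma> z (r *\<^sub>R x) = r * \<gamma> z x" for x y z r
    by (simp_all add: \<gamma>_def D_simps \<beta>_simps algebra_simps)
  have \<gamma>_swap: "\<gamma> y x = - \<gamma> x y" for x y
    using \<beta>_swap[of x y] \<beta>_swap[of "D x" y] \<beta>_swap[of x "D y"] by (simp add: \<gamma>_def)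
  have \<gamma>_self: "\<gamma> x x = 0" for x using \<gamma>_swap[of x x] by simp
  have \<gamma>_split: "\<gamma> x y = \<gamma> (J U) U * (\<tau> x * u y - u x * \<tau> y) + \<tau> x * \<gamma> (J U) v' - \<tau> y * \<gamma> (J U) v
      + u x * \<gamma> U v' - u y * \<gamma> U v"
    if "v \<in> V" "v' \<in> V" "x = \<tau> x *\<^sub>R J U + u x *\<^sub>R U + v" "y = \<tau> y *\<^sub>R J U + u y *\<^sub>R U + v'"
    for x y v v'
  proof -
    have "\<gamma> (p *\<^sub>R J U + q *\<^sub>R U + v) (p' *\<^sub>R J U + q' *\<^sub>R U + v') =
      \<gamma> (J U) U * (p * q' - q * p') + p * \<gamma> (J U) v' - p' * \<gamma> (J U) v + q * \<gamma> U v' - q' * \<gamma> U v"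
      for p q p' q'
      using \<gamma>_swap[of "J U" U] \<gamma>_swap[of "J U" v] \<gamma>_swap[of U v] that(1,2)
      by (simp add: \<gamma>_simps \<gamma>_self \<gamma>_V algebra_simps)
    from this[of "\<tau> x" "u x" "\<tau> y" "u y"] show ?thesis
      unfolding that(3,4)[symmetric] .
  qed
  let ?H = "bismut_torsion br J g"
  define h where "h x y z = ?H [x, y, z]" for x y z
  have h_br: "h (br x y) z w = \<tau> x * h (D y) z w - \<tau> y * h (D x) z w" for x y z w
    by (simp add: h_def torsion br_eq u_simps \<beta>_simps algebra_simps)
  have h_swap: "h y (D z) w = - h (D z) y w" "h y z (D w) = h (D w) y z" for y z w
    using \<beta>_swap[of y "D z"] \<beta>_swap[of y w] \<beta>_swap[of "D z" w] by (simp_all add: h_def torsion)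
  \<comment> \<open>\<open>D\<close> acts on H = u \<and> \<beta> as a derivation: it multiplies
    \<open>u\<close> by \<open>a\<close> and turns \<beta> into the first two terms of
    \<gamma>.\<close>
  have h_D: "h (D x) y z + h x (D y) z + h x y (D z) + t * h x y z =
      u x * \<gamma> y z + u y * \<gamma> z x + u z * \<gamma> x y" for x y z
    by (simp add: h_def torsion \<gamma>_def u_D algebra_simps)
  have "ce_d br ?H [x, y, z, w] = wedge1 (\<lambda>x. t * \<tau> x) ?H [x, y, z, w]" for x y z w
  proof -
    have "ce_d br ?H [x, y, z, w] - wedge1 (\<lambda>x. t * \<tau> x) ?H [x, y, z, w] =
        - \<tau> x * (h (D y) z w + h y (D z) w + h y z (D w) + t * h y z w)
        + \<tau> y * (h (D x) z w + h x (D z) w + h x z (D w) + t * h x z w)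
        - \<tau> z * (h (D x) y w + h x (D y) w + h x y (D w) + t * h x y w)
        + \<tau> w * (h (D x) y z + h x (D y) z + h x y (D z) + t * h x y z)"
      unfolding ce_d_3 wedge1_3 h_def[symmetric] h_br h_swap by (simp add: algebra_simps)
    also have "\<dots> = - \<tau> x * (u y * \<gamma> z w + u z * \<gamma> w y + u w * \<gamma> y z)
        + \<tau> y * (u x * \<gamma> z w + u z * \<gamma> w x + u w * \<gamma> x z)
        - \<tau> z * (u x * \<gamma> y w + u y * \<gamma> w x + u w * \<gamma> x y)
        + \<tau> w * (u x * \<gamma> y z + u y * \<gamma> z x + u z * \<gamma> x y)"
      unfolding h_D ..
    \<comment> \<open>The sum is \<tau> \<and> u \<and> \<gamma> up to sign. By
      \<open>\<gamma>_split\<close> every term of \<gamma> contains \<tau> or \<open>u\<close>, so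
      everything cancels.\<close>
    also have "\<dots> = 0"
    proof -
      obtain x' where x: "x' \<in> V" "x = \<tau> x *\<^sub>R J U + u x *\<^sub>R U + x'" by (rule splitting')
      obtain y' where y: "y' \<in> V" "y = \<tau> y *\<^sub>R J U + u y *\<^sub>R U + y'" by (rule splitting')
      obtain z' where z: "z' \<in> V" "z = \<tau> z *\<^sub>R J U + u z *\<^sub>R U + z'" by (rule splitting')
      obtain w' where w: "w' \<in> V" "w = \<tau> w *\<^sub>R J U + u w *\<^sub>R U + w'" by (rule splitting')
      note s = \<gamma>_split[OF x(1) y(1) x(2) y(2)] \<gamma>_split[OF x(1) z(1) x(2) z(2)]
        \<gamma>_split[OF x(1) w(1) x(2) w(2)] \<gamma>_split[OF y(1) z(1) y(2) z(2)]
        \<gamma>_split[OF y(1) w(1) y(2) w(2)] \<gamma>_split[OF z(1) w(1) z(2) w(2)]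
      show ?thesis
        unfolding \<gamma>_swap[of z x] \<gamma>_swap[of w x] \<gamma>_swap[of w y] s
        by (simp add: algebra_simps)
    qed
    finally show ?thesis by simp
  qed
  moreover have "linear (\<lambda>x. t * \<tau> x)"
    by (rule linearI) (simp_all add: \<tau>_simps algebra_simps)
  moreover have "hermitian_metric J g"
    using inner_product g_J by (simp add: hermitian_metric_def)
  moreover have "ce_d br (one_form (\<lambda>x. t * \<tau> x)) [x, y] = 0" for x y
    by (simp add: ce_d_one_form br_eq \<tau>_simps \<tau>_D)
  ultimately show ?thesis unfolding twisted_SKT_def by blast
qed

end

section \<open>Eigenvector tests, restrictions and linear adjoints\<close>

lemma complex_diagonalizable_subset:
  assumes "complex_diagonalizable V f" "subspace G"
    and "\<And>x y c. x \<in> V \<Longrightarrow> y \<in> V \<Longrightarrow> (x, y) \<noteq> 0 \<Longrightarrow> map_prod f f (x, y) = cscale c (x, y) \<Longrightarrow> x \<in> G \<and> y \<in> G"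
  shows "V \<subseteq> G"
proof
  fix x assume "x \<in> V"
  \<comment> \<open>\<open>G \<times> G\<close> is a complex subspace, so it can be tested on
    eigenvectors; the pair (x, x) brings the result back to the real space.\<close>
  then have "(x, x) \<in> V \<times> V" by simp
  then have "(x, x) \<in> G \<times> G"
    by (rule complex_diagonalizable_induct[OF assms(1)])
      (use subspace_complexification[OF assms(2)] assms(3) in auto)
  then show "x \<in> G" by simp
qed

lemma normal_on_cong:
  assumes "\<And>x. x \<in> V \<Longrightarrow> f x = f' x"
  shows "normal_on V g f \<longleftrightarrow> normal_on V g f'"
  unfolding normal_on_def using assms by (intro ex_cong1) auto

lemma complex_spectrum_cong:
  assumes "\<And>x. x \<in> V \<Longrightarrow> f x = f' x"
  shows "complex_spectrum V f = complex_spectrum V f'"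
proof -
  have "map_prod f f w = map_prod f' f' w" if "w \<in> V \<times> V" for w
    using that assms by auto
  then show ?thesis unfolding complex_spectrum_def by (intro Collect_cong bex_cong) auto
qed

lemma complex_spectrumE:
  assumes "r \<in> complex_spectrum V f"
  obtains x y where "x \<in> V" "y \<in> V" "(x, y) \<noteq> 0" "map_prod f f (x, y) = cscale r (x, y)"
proof -
  have "\<exists>w\<in>V \<times> V. w \<noteq> 0 \<and> map_prod f f w = cscale r w"
    using assms unfolding complex_spectrum_def by (rule CollectD)
  then show ?thesis using that by (metis SigmaE)
qed

context inner_product_space
begin

text \<open>\<open>normal_on\<close> constrains its adjoint on \<open>V\<close> only. Adjoints agree
  on \<open>V\<close>, so the globally linear one of \<open>adjoint_exists\<close> can take its
  place.\<close>

lemma normal_onE: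
  assumes "normal_on V g f" "subspace V" "linear f" "f ` V \<subseteq> V"
  obtains h where "linear h" "h ` V \<subseteq> V" "\<And>x y. x \<in> V \<Longrightarrow> y \<in> V \<Longrightarrow> g (f x) y = g x (h y)"
    "\<And>x. x \<in> V \<Longrightarrow> f (h x) = h (f x)"
proof -
  obtain k where k: "\<And>x. x \<in> V \<Longrightarrow> k x \<in> V" "\<And>x y. x \<in> V \<Longrightarrow> y \<in> V \<Longrightarrow> g (f x) y = g x (k y)"
    "\<And>x. x \<in> V \<Longrightarrow> f (k x) = k (f x)"
    using assms(1) unfolding normal_on_def by blast
  obtain h where h: "linear h" "range h \<subseteq> V" "\<And>x y. x \<in> V \<Longrightarrow> g (f x) y = g x (h y)"
    using adjoint_exists[OF assms(2,3)] by blast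
  have hk: "h x = k x" if "x \<in> V" for x
  proof (rule eqI[OF assms(2)])
    show "h x \<in> V" "k x \<in> V" using h(2) k(1) that by auto
    show "g (h x) z = g (k x) z" if "z \<in> V" for z
      using h(3)[OF that, of x] k(2)[OF that \<open>x \<in> V\<close>] by (simp add: commute)
  qed
  show ?thesis
  proof (rule that[of h])
    show "f (h x) = h (f x)" if "x \<in> V" for x
      using hk[of x] hk[of "f x"] k(3) that assms(4) by auto
  qed (use h in auto)
qed

lemma normal_on_imp_complex_diagonalizable:
  assumes "normal_on V g f" "subspace V" "linear f" "f ` V \<subseteq> V"
  shows "complex_diagonalizable V f"
proof -
  obtain h where h: "linear h" "h ` V \<subseteq> V" "\<And>x y. x \<in> V \<Longrightarrow> y \<in> V \<Longrightarrow> g (f x) y = g x (h y)"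
    "\<And>x. x \<in> V \<Longrightarrow> f (h x) = h (f x)"
    using normal_onE[OF assms] by blast
  show ?thesis by (rule normal_complex_diagonalizable[OF assms(2,4) h(2) assms(3) h(1,3,4)])
qed

end

section \<open>The torsion condition in terms of the adjoint of \<open>D\<close>\<close>

context hermitian_splitting
begin

context
  fixes h :: "'a \<Rightarrow> 'a"
  assumes linear_h: "linear h" and h_V: "h ` V \<subseteq> V"
    and adjoint_h: "\<forall>x\<in>V. \<forall>y\<in>V. g (D x) y = g x (h y)"
begin

lemma adjoint: "x \<in> V \<Longrightarrow> y \<in> V \<Longrightarrow> g (D x) y = g x (h y)"
  using adjoint_h by blast

text \<open>\<open>h\<close> is the adjoint of \<open>D\<close> on \<open>V\<close>, so
  \<open>P\<close> is twice the symmetric part of \<open>D\<close> there.\<close>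

definition P :: "'a \<Rightarrow> 'a" where "P x = D x + h x"

lemma linear_P: "linear P"
  unfolding P_def by (intro linear_compose_add linear_D linear_h)

lemma h_in_V: "v \<in> V \<Longrightarrow> h v \<in> V" and P_V: "v \<in> V \<Longrightarrow> P v \<in> V"
  using h_V D_V V(1) by (auto simp: P_def subspace_add)

lemma P_symmetric: "x \<in> V \<Longrightarrow> y \<in> V \<Longrightarrow> g (P x) y = g x (P y)"
  using adjoint[of x y] adjoint[of y x] by (simp add: P_def inner_simps commute)

text \<open>Adjoint form of \<open>D_J\<close>, since \<open>J\<close> is skew for
  \<open>g\<close>.\<close>

lemma h_J: "x \<in> V \<Longrightarrow> h (J x) = J (h x)"
proof (rule eqI[OF V(1)])
  fix z assume x: "x \<in> V" and z: "z \<in> V"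
  have "g z (h (J x)) = g (D z) (J x)" using adjoint x z V(2) by simp
  also have "\<dots> = - g (D (J z)) x" using z by (simp add: D_J g_J_left)
  also have "\<dots> = g z (J (h x))" using adjoint[of "J z" x] x z V(2) by (simp add: g_J_left)
  finally show "g (h (J x)) z = g (J (h x)) z" by (simp add: commute)
qed (use V(2) h_in_V in auto)

lemma \<beta>_eq: "y \<in> V \<Longrightarrow> z \<in> V \<Longrightarrow> \<beta> y z = g (J (P y)) z"
  using adjoint[of z "J y"] V(2)[of y]
  by (simp add: \<beta>_def P_def D_J J_simps inner_simps g_J_left h_J commute[of z])

text \<open>By \<open>\<beta>_eq\<close> all terms are values of \<open>g\<close>, and
  \<open>D\<close> in the second slot moves across as \<open>h\<close>; non-degeneracy on
  \<open>V\<close> removes \<open>z\<close>, and injectivity removes \<open>J\<close>.\<close>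

lemma \<beta>_condition_iff:
  "(\<forall>y\<in>V. \<forall>z\<in>V. \<beta> (D y) z + \<beta> y (D z) = c * \<beta> y z) \<longleftrightarrow>
    (\<forall>y\<in>V. P (D y) + h (P y) = c *\<^sub>R P y)"
proof -
  have *: "\<beta> (D y) z + \<beta> y (D z) = g (J (P (D y) + h (P y))) z" "c * \<beta> y z = g (J (c *\<^sub>R P y)) z"
    if "y \<in> V" "z \<in> V" for y z
    using that adjoint[of z "J (P y)"] commute[of "J (P y)" "D z"] commute[of z "J (h (P y))"]
    by (simp_all add: \<beta>_eq D_V J_simps inner_simps h_J P_V V(2))
  have "P (D y) + h (P y) = c *\<^sub>R P y"
    if "\<forall>z\<in>V. g (J (P (D y) + h (P y))) z = g (J (c *\<^sub>R P y)) z" "y \<in> V" for y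
  proof -
    have "J (P (D y) + h (P y)) = J (c *\<^sub>R P y)"
      using that V(1) by (intro eqI[OF V(1)] V(2))
        (auto intro!: subspace_add subspace_scale h_in_V P_V D_V)
    then have "J (J (P (D y) + h (P y))) = J (J (c *\<^sub>R P y))" by (rule arg_cong)
    then show ?thesis unfolding J_J neg_equal_iff_equal .
  qed
  note imp = this
  show ?thesis
  proof (intro iffI ballI)
    fix y assume L: "\<forall>y\<in>V. \<forall>z\<in>V. \<beta> (D y) z + \<beta> y (D z) = c * \<beta> y z" and y: "y \<in> V"
    have "g (J (P (D y) + h (P y))) z = g (J (c *\<^sub>R P y)) z" if "z \<in> V" for z
      using L y that unfolding *(1)[OF y that, symmetric] *(2)[OF y that, symmetric] by blast
    then show "P (D y) + h (P y) = c *\<^sub>R P y" using imp y by blast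
  next
    fix y z assume "\<forall>y\<in>V. P (D y) + h (P y) = c *\<^sub>R P y" "y \<in> V" "z \<in> V"
    then show "\<beta> (D y) z + \<beta> y (D z) = c * \<beta> y z" by (simp only: *)
  qed
qed

text \<open>Both conclusions are linear in \<open>x\<close>, which is why they extend from
  eigenvectors to \<open>V\<close> in \<open>P_condition_imp\<close>.\<close>

lemma P_eigenvector:
  assumes "x \<in> V" "P x = p *\<^sub>R x" and c: "\<forall>y\<in>V. P (D y) + h (P y) = c *\<^sub>R P y"
  shows "P (P x) = c *\<^sub>R P x" "P (D x) = D (P x)"
proof -
  note s = linear_scale[OF linear_P] linear_scale[OF linear_h] linear_scale[OF linear_D]
  have e: "P (D x) + p *\<^sub>R h x = (c * p) *\<^sub>R x"
    using c assms(1) by (auto simp: assms(2) s)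
  \<comment> \<open>Pairing \<open>e\<close> with \<open>x\<close>: by symmetry of \<open>P\<close>
    the contributions of \<open>D\<close> and \<open>h\<close> add up to
    \<open>p * g (P x) x\<close>.\<close>
  have "g (P (D x)) x = p * g (D x) x"
    using P_symmetric[of "D x" x] D_V assms(1) by (simp add: assms(2) inner_simps)
  moreover have "g (P x) x = g (D x) x + g (h x) x" by (simp only: P_def add_left)
  ultimately have "g (P (D x) + p *\<^sub>R h x) x = p * g (P x) x"
    by (simp add: add_left scale_left distrib_left)
  then have "c * p * g x x = p * p * g x x"
    unfolding e assms(2) scale_left by auto
  then have cp: "(c * p) *\<^sub>R x = (p * p) *\<^sub>R x"
    using eq_zero_iff[of x] by (cases "x = 0") auto
  then show "P (P x) = c *\<^sub>R P x" by (simp only: assms(2) s scaleR_scaleR)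
  have "P (D x) = p *\<^sub>R (P x - h x)"
    using e cp by (simp add: assms(2) scaleR_diff_right eq_diff_eq)
  also have "P x - h x = D x" by (simp add: P_def)
  finally show "P (D x) = D (P x)" by (simp only: assms(2) s)
qed

text \<open>\<open>P\<close> is its own adjoint on \<open>V\<close>, hence normal and
  diagonalizable, so \<open>P_eigenvector\<close> reaches all of \<open>V\<close>. As
  \<open>P\<close> is the sum of \<open>D\<close> and \<open>h\<close>, commuting with
  \<open>D\<close> means the same for \<open>P\<close> and \<open>h\<close>.\<close>

lemma P_condition_imp:
  assumes "\<forall>y\<in>V. P (D y) + h (P y) = c *\<^sub>R P y" "x \<in> V"
  shows "P (P x) = c *\<^sub>R P x" "D (h x) = h (D x)"
proof -
  let ?G = "{x. P (P x) = c *\<^sub>R P x \<and> P (D x) = D (P x)}"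
  note s = linear_add[OF linear_P] linear_scale[OF linear_P] linear_0[OF linear_P] D_simps
  have P: "complex_diagonalizable V P"
    by (rule normal_complex_diagonalizable[where h = P])
      (use V(1) P_V linear_P P_symmetric in auto)
  have "V \<subseteq> ?G"
  proof (rule complex_diagonalizable_subset[OF P])
    show "subspace ?G" by (auto simp: subspace_def s scaleR_add_right)
    fix x y r assume xy: "x \<in> V" "y \<in> V" "(x, y) \<noteq> 0" and r: "map_prod P P (x, y) = cscale r (x, y)"
    \<comment> \<open>Self-adjointness makes \<open>r\<close> real, so that \<open>P\<close> acts by
      \<open>Re r\<close> on \<open>x\<close> and \<open>y\<close> separately.\<close>
    have "map_prod P P (x, y) = cscale (cnj r) (x, y)"
      by (rule normal_adjoint_kernel[where f = P])
        (use V(1) P_V linear_P P_symmetric xy r in auto)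
    with r have "cscale r (x, y) = cscale (cnj r) (x, y)" by simp
    then have "r = cnj r" using xy(3) by (simp only: cplx.scale_cancel_right) simp
    then have "Im r = 0" by (simp add: complex_eq_iff)
    with r have "P x = Re r *\<^sub>R x" "P y = Re r *\<^sub>R y" by (auto simp: cscale_def)
    then show "x \<in> ?G \<and> y \<in> ?G" using P_eigenvector xy assms(1) by blast
  qed
  then show "P (P x) = c *\<^sub>R P x" using assms(2) by blast
  have "P (D x) = D (P x)" using \<open>V \<subseteq> ?G\<close> assms(2) by blast
  then show "D (h x) = h (D x)" by (simp add: P_def D_simps)
qed

text \<open>By normality \<open>h\<close> acts by \<open>cnj r\<close> on an
  \<open>r\<close>-eigenvector of \<open>D\<close>; as \<open>r + cnj r\<close> is real, real and
  imaginary parts decouple.\<close>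

lemma P_on_eigenvector:
  assumes "\<forall>x\<in>V. D (h x) = h (D x)" "x \<in> V" "y \<in> V" "map_prod D D (x, y) = cscale r (x, y)"
  shows "P x = (2 * Re r) *\<^sub>R x" "P y = (2 * Re r) *\<^sub>R y"
proof -
  have "map_prod h h (x, y) = cscale (cnj r) (x, y)"
    by (rule normal_adjoint_kernel[where f = D])
      (use V(1) D_V h_V linear_D linear_h adjoint assms in auto)
  with assms(4) show "P x = (2 * Re r) *\<^sub>R x" "P y = (2 * Re r) *\<^sub>R y"
    by (auto simp: P_def cscale_def scaleR_add_left[symmetric])
qed

end

lemma twisted_SKT_iff:
  "twisted_SKT br J g \<longleftrightarrow>
    normal_on V g D \<and> (\<exists>\<mu>::real. \<forall>c\<in>complex_spectrum V D. Re c \<in> {0, \<mu>})"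
proof safe
  assume "twisted_SKT br J g"
  then obtain c where c: "\<forall>y\<in>V. \<forall>z\<in>V. \<beta> (D y) z + \<beta> y (D z) = c * \<beta> y z"
    using twisted_SKT_imp by blast
  obtain h where "linear h" "range h \<subseteq> V" "\<And>x y. x \<in> V \<Longrightarrow> g (D x) y = g x (h y)"
    using adjoint_exists[OF V(1) linear_D] by blast
  then have h: "linear h" "h ` V \<subseteq> V" "\<forall>x\<in>V. \<forall>y\<in>V. g (D x) y = g x (h y)"
    by auto
  note c' = iffD1[OF \<beta>_condition_iff[OF h] c]
  note n = P_condition_imp[OF h c']
  have com: "\<forall>x\<in>V. D (h x) = h (D x)" using n(2) by blast
  show "normal_on V g D"
    unfolding normal_on_def using h com by (intro exI[of _ h] conjI) blast+
  \<comment> \<open>\<open>P\<close> acts by 2 Re r on the eigenvector, and P^2 = c P leaves only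
    the values 0 and \<open>c\<close>.\<close>
  have "Re r \<in> {0, c / 2}" if r: "r \<in> complex_spectrum V D" for r
  proof -
    obtain x y where xy: "x \<in> V" "y \<in> V" "(x, y) \<noteq> 0" "map_prod D D (x, y) = cscale r (x, y)"
      using r by (rule complex_spectrumE)
    define p where "p = 2 * Re r"
    have p: "P h x = p *\<^sub>R x" "P h y = p *\<^sub>R y"
      using P_on_eigenvector[OF h com xy(1,2,4)] by (simp_all add: p_def)
    have "(p * p) *\<^sub>R x = (c * p) *\<^sub>R x" "(p * p) *\<^sub>R y = (c * p) *\<^sub>R y"
      using n(1)[OF xy(1)] n(1)[OF xy(2)] by (simp_all add: p linear_scale[OF linear_P[OF h]])
    with xy(3) have "p * p = c * p" by (auto simp: zero_prod_def)
    then show ?thesis by (auto simp: p_def)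
  qed
  then show "\<exists>\<mu>::real. \<forall>c\<in>complex_spectrum V D. Re c \<in> {0, \<mu>}" by blast
next
  fix \<mu> :: real
  assume n: "normal_on V g D" and \<mu>: "\<forall>c\<in>complex_spectrum V D. Re c \<in> {0, \<mu>}"
  have D_V': "D ` V \<subseteq> V" using D_V by blast
  obtain h where h: "linear h" "h ` V \<subseteq> V" "\<forall>x\<in>V. \<forall>y\<in>V. g (D x) y = g x (h y)"
    and com: "\<forall>x\<in>V. D (h x) = h (D x)"
    using normal_onE[OF n V(1) linear_D D_V'] by metis
  let ?P = "P h"
  \<comment> \<open>The relation P^2 = 2 \<mu> P is tested on eigenvectors of \<open>D\<close>,
    where \<open>P\<close> acts by 0 or 2 \<mu>.\<close>
  let ?G = "{x. ?P (?P x) = (2 * \<mu>) *\<^sub>R ?P x}"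
  note s = linear_add[OF linear_P[OF h]] linear_scale[OF linear_P[OF h]] linear_0[OF linear_P[OF h]]
  have "V \<subseteq> ?G"
  proof (rule complex_diagonalizable_subset[OF
        normal_on_imp_complex_diagonalizable[OF n V(1) linear_D D_V']])
    show "subspace ?G" by (auto simp: subspace_def s scaleR_add_right)
    fix x y r assume xy: "x \<in> V" "y \<in> V" "(x, y) \<noteq> 0" "map_prod D D (x, y) = cscale r (x, y)"
    then have "r \<in> complex_spectrum V D" unfolding complex_spectrum_def by blast
    then have "Re r = 0 \<or> Re r = \<mu>" using \<mu> by blast
    then show "x \<in> ?G \<and> y \<in> ?G"
      using P_on_eigenvector[OF h com xy(1,2,4)] by (auto simp: s)
  qed
  \<comment> \<open>Normality makes \<open>?P\<close> commute with \<open>D\<close>, so the left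
    side is D P + h P = P^2.\<close>
  then have "?P (D y) + h (?P y) = (2 * \<mu>) *\<^sub>R ?P y" if "y \<in> V" for y
  proof -
    have "?P (D y) = D (?P y)" using com that by (simp add: P_def[OF h] D_simps)
    then have "?P (D y) + h (?P y) = ?P (?P y)" by (simp add: P_def[OF h])
    with \<open>V \<subseteq> ?G\<close> that show ?thesis by auto
  qed
  then have "\<forall>y\<in>V. \<forall>z\<in>V. \<beta> (D y) z + \<beta> y (D z) = (2 * \<mu>) * \<beta> y z"
    unfolding \<beta>_condition_iff[OF h] by blast
  then show "twisted_SKT br J g" by (intro twisted_SKT_if) auto
qed

end

section \<open>Metrics making a diagonalizable map normal\<close>

text \<open>Through \<open>J\<close> the space is complex, \<open>V\<close> is a complex subspace
  and \<open>f\<close> is complex linear on it. A complex eigenbasis of \<open>V\<close>, extended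
  to the whole space, is declared unitary.\<close>

lemma hermitian_normal_exists:
  fixes J :: "'a::real_vector \<Rightarrow> 'a"
  assumes fd: "\<exists>B::'a set. finite B \<and> span B = UNIV"
    and J: "linear J" "\<And>x. J (J x) = - x"
    and V: "subspace V" "\<And>v. v \<in> V \<Longrightarrow> J v \<in> V"
    and f: "linear f" "\<And>v. v \<in> V \<Longrightarrow> f v \<in> V" "\<And>v. v \<in> V \<Longrightarrow> f (J v) = J (f v)"
    and diag: "complex_diagonalizable V f"
  shows "\<exists>g. hermitian_metric J g \<and> normal_on V g f"
proof -
  define js where "js c x = Re c *\<^sub>R x + Im c *\<^sub>R J x" for c x
  note Js = linear_add[OF J(1)] linear_diff[OF J(1)] linear_scale[OF J(1)] linear_0[OF J(1)] J(2)
  note fs = linear_add[OF f(1)] linear_diff[OF f(1)] linear_scale[OF f(1)] linear_0[OF f(1)]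
  interpret jc: vector_space js
    by unfold_locales (auto simp: js_def Js algebra_simps)
  have js_V: "js c v \<in> V" if "v \<in> V" for c v
    using that V by (simp add: js_def subspace_add subspace_scale)
  have jc_V: "jc.subspace V"
    using V(1) js_V by (auto simp: jc.subspace_def subspace_0 subspace_add)
  have f_js: "f (js c v) = js c (f v)" if "v \<in> V" for c v
    using that by (simp add: js_def fs f(3))
  \<comment> \<open>The complex linear map \<open>(x, y) \<mapsto> x + J y\<close> from \<open>V \<times> V\<close> onto \<open>V\<close>, with \<open>J\<close> as imaginary unit,
    commutes with \<open>f\<close>, so it carries the complex eigenvectors to vectors spanning \<open>V\<close>.\<close>
  define S where "S = {z \<in> V. \<exists>c. f z = js c z}"
  have "V \<subseteq> jc.span S"
  proof
    fix x assume "x \<in> V"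
    have "fst w + J (snd w) \<in> jc.span S" if "w \<in> V \<times> V" for w
    proof (rule complex_diagonalizable_induct[OF diag that])
      have "fst (cscale c w) + J (snd (cscale c w)) = js c (fst w + J (snd w))" for c w
        by (simp add: js_def cscale_def Js algebra_simps)
      then show "cplx.subspace {w. fst w + J (snd w) \<in> jc.span S}"
        using jc.span_add[of _ S]
        by (auto simp: cplx.subspace_def Js jc.span_zero jc.span_scale) (metis add.assoc add.left_commute)
    next
      fix w c assume w: "w \<in> V \<times> V" "map_prod f f w = cscale c w"
      obtain x y where xy: "w = (x, y)" "x \<in> V" "y \<in> V" using w by auto
      have "f x = Re c *\<^sub>R x - Im c *\<^sub>R y" "f y = Im c *\<^sub>R x + Re c *\<^sub>R y"
        using w(2) by (auto simp: xy cscale_def)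
      then have "f (x + J y) = js c (x + J y)"
        using xy by (simp add: fs f(3) Js js_def algebra_simps)
      then show "fst w + J (snd w) \<in> jc.span S"
        using xy V by (intro jc.span_base) (auto simp: S_def subspace_add)
    qed
    from this[of "(x, 0)"] \<open>x \<in> V\<close> show "x \<in> jc.span S"
      using V(1) by (simp add: Js subspace_0)
  qed
  obtain B0 where B0: "B0 \<subseteq> S" "jc.independent B0" "S \<subseteq> jc.span B0"
    using jc.maximal_independent_subset[of S] by blast
  have B0_V: "B0 \<subseteq> V" and span_B0: "jc.span B0 = V"
  proof -
    show "B0 \<subseteq> V" using B0(1) by (auto simp: S_def)
    then have "jc.span B0 \<subseteq> V" by (rule jc.span_minimal[OF _ jc_V])
    moreover have "V \<subseteq> jc.span B0"
      using \<open>V \<subseteq> jc.span S\<close> jc.span_minimal[OF B0(3) jc.subspace_span] by blast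
    ultimately show "jc.span B0 = V" by blast
  qed
  define B where "B = jc.extend_basis B0"
  have B: "B0 \<subseteq> B" "jc.independent B" "jc.span B = UNIV"
    using jc.extend_basis_superset[OF B0(2)] jc.independent_extend_basis[OF B0(2)]
      jc.span_extend_basis[OF B0(2)] by (simp_all add: B_def)
  \<comment> \<open>A real relation is also a complex one; real independence then gives
    finiteness.\<close>
  have "independent B"
  proof
    assume "dependent B"
    then obtain T c where T: "finite T" "T \<subseteq> B" "(\<Sum>v\<in>T. c v *\<^sub>R v) = 0" "\<exists>v\<in>T. c v \<noteq> 0"
      by (auto simp: dependent_explicit)
    then have "(\<Sum>v\<in>T. js (of_real (c v)) v) = 0" by (simp add: js_def)
    moreover have "\<exists>v\<in>T. complex_of_real (c v) \<noteq> 0" using T(4) by simp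
    ultimately have "jc.dependent B"
      unfolding jc.dependent_explicit using T(1,2)
      by (intro exI[of _ T] exI[of _ "\<lambda>v. complex_of_real (c v)"]) auto
    with B(2) show False by simp
  qed
  then have fin: "finite B"
    using fd independent_span_bound[of _ B] by auto
  define r where "r = jc.representation B"
  have r_add: "r (x + y) b = r x b + r y b" and r_js: "r (js c x) b = c * r x b" for x y b c
    using B by (simp_all add: r_def jc.representation_add jc.representation_scale)
  have r_scale: "r (k *\<^sub>R x) b = of_real k * r x b" and r_J: "r (J x) b = \<i> * r x b" for k x b
    using r_js[of "of_real k" x b] r_js[of \<i> x b] by (simp_all add: js_def)
  have r_sum: "r (\<Sum>b\<in>A. v b) b' = (\<Sum>b\<in>A. r (v b) b')" for A and v :: "'a \<Rightarrow> 'a" and b'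
    using B by (simp add: r_def jc.representation_sum)
  have r_basis: "r z b = (if b = z then 1 else 0)" if "z \<in> B" for z b
    using B(2) that by (simp add: r_def jc.representation_basis)
  have expand: "(\<Sum>b\<in>B. js (r x b) b) = x" for x
    using jc.sum_representation_eq[OF B(2) _ fin subset_refl] B(3) by (simp add: r_def)
  \<comment> \<open>Real part of the standard Hermitian form in the coordinates \<open>r\<close>;
    multiplying both arguments by \<open>\<i>\<close> preserves it.\<close>
  define g where "g x y = Re (\<Sum>b\<in>B. r x b * cnj (r y b))" for x y
  have "hermitian_metric J g"
    unfolding hermitian_metric_def inner_product_def
  proof (intro conjI allI impI)
    show "bilinear g"
      unfolding bilinear_def
      by (auto simp: g_def r_add r_scale sum.distrib sum_distrib_left algebra_simps intro!: linearI)
    show "g x y = g y x" for x y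
      by (simp add: g_def algebra_simps)
    show "g (J x) (J y) = g x y" for x y
      by (simp add: g_def r_J algebra_simps)
    fix x :: 'a assume "x \<noteq> 0"
    have "\<exists>b\<in>B. r x b \<noteq> 0"
    proof (rule ccontr)
      assume "\<not> ?thesis"
      then have "(\<Sum>b\<in>B. js (r x b) b) = 0" by simp
      with expand[of x] \<open>x \<noteq> 0\<close> show False by simp
    qed
    then obtain b where b: "b \<in> B" "r x b \<noteq> 0" by blast
    have "g x x = (\<Sum>b\<in>B. (norm (r x b))\<^sup>2)"
      by (simp add: g_def complex_mult_cnj cmod_power2)
    also have "\<dots> > 0" using b by (intro sum_pos2[OF fin b(1)]) auto
    finally show "g x x > 0" .
  qed
  moreover have "normal_on V g f"
  proof -
    \<comment> \<open>Eigenvalues on the basis of \<open>V\<close>; the value 0 on the added basis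
      vectors makes \<open>h\<close> below map into \<open>V\<close>.\<close>
    have "\<exists>l. \<forall>b. (b \<in> B0 \<longrightarrow> f b = js (l b) b) \<and> (b \<notin> B0 \<longrightarrow> l b = 0)"
      using B0(1) unfolding S_def by (intro choice) auto
    then obtain l where l: "\<And>b. b \<in> B0 \<Longrightarrow> f b = js (l b) b" "\<And>b. b \<notin> B0 \<Longrightarrow> l b = 0"
      by blast
    have "x \<in> V \<and> (\<forall>b. r (f x) b = l b * r x b)" if "x \<in> jc.span B0" for x
      using that
    proof (induction rule: jc.span_induct_alt)
      case base
      have "r 0 b = 0" for b using r_scale[of 0 0 b] by simp
      then show ?case using V(1) by (simp add: fs subspace_0)
    next
      case (step c x y)
      then have x: "x \<in> V" "x \<in> B" using B0_V B(1) by auto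
      then have "f (js c x + y) = js c (js (l x) x) + f y"
        using step by (simp only: fs f_js l(1))
      then have "r (f (js c x + y)) b = l b * r (js c x + y) b" for b
        using step x by (simp only: r_add r_js r_basis) (simp add: algebra_simps)
      then show ?case using step x js_V V(1) by (simp add: subspace_add)
    qed
    then have r_f: "r (f x) b = l b * r x b" if "x \<in> V" for x b using that span_B0 by blast
    \<comment> \<open>In a unitary basis the adjoint of a diagonal map has the conjugate
      eigenvalues.\<close>
    define h where "h x = (\<Sum>b\<in>B. js (cnj (l b) * r x b) b)" for x
    have r_h: "r (h x) b = cnj (l b) * r x b" for x b
    proof -
      have "r (h x) b = (\<Sum>b'\<in>B. if b' = b then cnj (l b) * r x b else 0)"
        unfolding h_def r_sum by (intro sum.cong) (auto simp: r_js r_basis)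
      also have "\<dots> = cnj (l b) * r x b"
        using fin B(1) l(2)[of b] by auto
      finally show ?thesis .
    qed
    have h_V: "h x \<in> V" for x
      unfolding h_def
    proof (intro jc.subspace_sum[OF jc_V])
      fix b assume "b \<in> B"
      show "js (cnj (l b) * r x b) b \<in> V"
      proof (cases "b \<in> B0")
        case True then show ?thesis using B0_V js_V by blast
      next
        case False then show ?thesis using l(2) jc.subspace_0[OF jc_V] by simp
      qed
    qed
    show ?thesis
      unfolding normal_on_def
    proof (intro exI[of _ h] conjI ballI)
      show "h x \<in> V" for x by (rule h_V)
      show "g (f x) y = g x (h y)" if "x \<in> V" for x y
        using that by (simp add: g_def r_f r_h mult_ac)
      show "f (h x) = h (f x)" if "x \<in> V" for x
      proof -
        have "r (f (h x)) b = r (h (f x)) b" for b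
          using that h_V by (simp add: r_f r_h)
        then have "(\<Sum>b\<in>B. js (r (f (h x)) b) b) = (\<Sum>b\<in>B. js (r (h (f x)) b) b)"
          by (simp only:)
        then show ?thesis unfolding expand .
      qed
    qed
  qed
  ultimately show ?thesis by blast
qed

section \<open>Adapted bases\<close>

locale almost_abelian_adapted =
  fixes br :: "'a::real_vector \<Rightarrow> 'a \<Rightarrow> 'a" and J :: "'a \<Rightarrow> 'a" and N :: "'a set"
    and n :: nat and e :: "nat \<Rightarrow> 'a"
  assumes almost_abelian: "almost_abelian br N"
    and complex_structure: "complex_structure br J"
    and adapted_basis: "adapted_basis J N n e"
begin

abbreviation V :: "'a set" where "V \<equiv> n1 J N"
abbreviation f :: "'a \<Rightarrow> 'a" where "f \<equiv> br (e (2 * n))"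

lemma bilinear_br: "bilinear br" and br_self: "br x x = 0"
  and finite_dim: "\<exists>B::'a set. finite B \<and> span B = UNIV"
  and nonabelian: "\<exists>x y. br x y \<noteq> 0"
  and subspace_N: "subspace N" and br_N: "y \<in> N \<Longrightarrow> br x y \<in> N"
  and abelian_N: "x \<in> N \<Longrightarrow> y \<in> N \<Longrightarrow> br x y = 0"
  using almost_abelian by (auto simp: almost_abelian_def abelian_ideal_def lie_algebra_def)

lemma linear_J: "linear J" and J_J: "J (J x) = - x"
  and integrable: "br (J x) (J y) - br x y - J (br (J x) y) - J (br x (J y)) = 0"
  using complex_structure by (auto simp: complex_structure_def)

lemmas br_simps = bilinear_ladd[OF bilinear_br] bilinear_radd[OF bilinear_br]
  bilinear_lsub[OF bilinear_br] bilinear_rsub[OF bilinear_br]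
  bilinear_lmul[OF bilinear_br] bilinear_rmul[OF bilinear_br]
lemmas J_simps = linear_add[OF linear_J] linear_diff[OF linear_J] linear_scale[OF linear_J]
  linear_neg[OF linear_J] linear_0[OF linear_J] J_J

lemma linear_f: "linear f"
  using bilinear_br by (simp add: bilinear_def)

lemma basis: "inj_on e {1..2 * n}" "independent (e ` {1..2 * n})" "span (e ` {1..2 * n}) = UNIV"
    "span (e ` {2..<2 * n}) = V" "span (e ` {1..<2 * n}) = N" "J (e 1) = e (2 * n)"
  using adapted_basis by (simp_all add: adapted_basis_def)

lemma subspace_V: "subspace V"
  using basis(4) subspace_span by metis

lemma V_N: "v \<in> V \<Longrightarrow> v \<in> N"
  by (simp add: n1_def)

lemma V_iff: "v \<in> V \<longleftrightarrow> v \<in> N \<and> J v \<in> N"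
proof
  assume v: "v \<in> V"
  then obtain w where "w \<in> N" "v = J w" by (auto simp: n1_def)
  then show "v \<in> N \<and> J v \<in> N"
    using V_N[OF v] subspace_neg[OF subspace_N] by (simp add: J_J)
next
  assume v: "v \<in> N \<and> J v \<in> N"
  then have "v = J (- J v)" "- J v \<in> N"
    using subspace_neg[OF subspace_N] by (simp_all add: J_simps)
  with v show "v \<in> V" by (auto simp: n1_def)
qed

lemma J_V: "v \<in> V \<Longrightarrow> J v \<in> V"
  using subspace_neg[OF subspace_N] by (auto simp: V_iff J_J)

text \<open>For \<open>n = 0\<close> the space is trivial, hence abelian. The bound puts 1 and 2n
  into the index sets below.\<close>

lemma n_pos: "n \<ge> 1"
proof (rule ccontr)
  assume "\<not> n \<ge> 1"
  then have "(UNIV :: 'a set) = {0}" using basis(3) by simp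
  then have "br x y = 0" for x y by blast
  with nonabelian show False by simp
qed

lemma N_split:
  assumes "x \<in> N"
  obtains k v where "v \<in> V" "x = k *\<^sub>R e 1 + v"
proof -
  have "{1..<2 * n} = insert 1 {2..<2 * n}" using n_pos by auto
  then have "x \<in> span (insert (e 1) (e ` {2..<2 * n}))" using basis(5) assms by simp
  then obtain k where "x - k *\<^sub>R e 1 \<in> V"
    using basis(4) by (auto simp: span_breakdown_eq)
  then show ?thesis using that[of "x - k *\<^sub>R e 1" k] by simp
qed

lemma split:
  obtains s k v where "v \<in> V" "x = s *\<^sub>R e (2 * n) + k *\<^sub>R e 1 + v"
proof -
  have "{1..2 * n} = insert (2 * n) {1..<2 * n}" using n_pos by auto
  then have "x \<in> span (insert (e (2 * n)) (e ` {1..<2 * n}))" using basis(3) by simp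
  then obtain s where "x - s *\<^sub>R e (2 * n) \<in> N"
    using basis(5) by (auto simp: span_breakdown_eq)
  then obtain k v where "v \<in> V" "x - s *\<^sub>R e (2 * n) = k *\<^sub>R e 1 + v" by (rule N_split)
  then show ?thesis using that[of v s k] by (simp add: diff_eq_eq add.commute add.left_commute)
qed

lemma e1_N: "e 1 \<in> N" and e1_V: "e 1 \<notin> V"
proof -
  show "e 1 \<in> N" using basis(5) n_pos by (auto intro: span_base)
  have "e k \<noteq> e 1" if "k \<in> {2..<2 * n}" for k
    using inj_onD[OF basis(1), of k 1] that by auto
  then have "e ` {2..<2 * n} \<subseteq> e ` {1..2 * n} - {e 1}" by fastforce
  moreover have "e 1 \<in> e ` {1..2 * n}" using n_pos by simp
  then have "e 1 \<notin> span (e ` {1..2 * n} - {e 1})"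
    using basis(2) unfolding dependent_def by blast
  ultimately show "e 1 \<notin> V" using span_mono basis(4) by blast
qed

text \<open>Two terms of the integrability condition at (U, v) vanish because \<open>U\<close>,
  \<open>v\<close> and \<open>J v\<close> lie in the abelian ideal. Then \<open>f v\<close> and
  \<open>J (f v)\<close> are both in \<open>N\<close>. The first premise admits both
  \<open>e 1\<close> and its orthogonal modification as \<open>U\<close>.\<close>

lemma ad_V:
  assumes "br (J U) v = f v" "U \<in> N" "v \<in> V"
  shows "br (J U) (J v) = J (f v)" "f v \<in> V"
proof -
  have "br U v = 0" "br U (J v) = 0"
    using abelian_N assms V_N J_V by auto
  then show *: "br (J U) (J v) = J (f v)"
    using integrable[of U v] assms(1) by (simp add: J_simps)
  have "br (J U) (J v) \<in> N" "f v \<in> N"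
    using assms(3) by (blast intro: br_N V_N J_V)+
  then show "f v \<in> V" unfolding * V_iff by simp
qed

lemma f_V: "v \<in> V \<Longrightarrow> f v \<in> V" and f_J: "v \<in> V \<Longrightarrow> f (J v) = J (f v)"
  using ad_V[of "e 1" v] e1_N by (simp_all add: basis(6) del: One_nat_def)

text \<open>To be orthogonal to \<open>V\<close>, the vector \<open>e 1\<close> is corrected by its
  projection. This changes \<open>J U\<close> by a vector of \<open>V\<close>, which acts trivially
  on the ideal, so \<open>J U\<close> and \<open>e (2 * n)\<close> act alike on
  \<open>V\<close>.\<close>

lemma twisted_SKT_iff_normal:
  assumes "hermitian_metric J g"
  shows "twisted_SKT br J g \<longleftrightarrow>
    normal_on V g f \<and> (\<exists>\<mu>::real. \<forall>c\<in>complex_spectrum V f. Re c \<in> {0, \<mu>})"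
proof -
  interpret inner_product_space g
    using assms finite_dim by unfold_locales (simp_all add: hermitian_metric_def)
  obtain p where p: "p \<in> V" "\<And>v. v \<in> V \<Longrightarrow> g (e 1 - p) v = 0"
    using orthogonal_projection[OF subspace_V] by blast
  define U where "U = e 1 - p"
  have U_N: "U \<in> N" using e1_N V_N[OF p(1)] subspace_N by (simp add: U_def subspace_diff)
  have JU: "J U = e (2 * n) - J p" by (simp only: U_def J_simps basis(6))
  have br_JU: "br (J U) v = f v" if "v \<in> V" for v
    using abelian_N[of "J p" v] V_N that J_V[OF p(1)] by (simp add: JU br_simps)
  obtain a w where w: "w \<in> V" "br (J U) U = a *\<^sub>R e 1 + w"
    using N_split[OF br_N[OF U_N]] by metis
  \<comment> \<open>Writing \<open>e 1\<close> as \<open>U + p\<close> moves the multiple of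
    \<open>p\<close> into the \<open>V\<close>-component of \<open>br (J U) U\<close>.\<close>
  interpret hermitian_splitting g br J V U a "a *\<^sub>R p + w"
  proof (rule hermitian_splitting.intro[OF inner_product_space_axioms],
      rule hermitian_splitting_axioms.intro)
    show "bilinear br" "br x x = 0" "linear J" "J (J x) = - x" "subspace V" for x
      by (fact bilinear_br br_self linear_J J_J subspace_V)+
    show "g (J x) (J y) = g x y" for x y using assms by (simp add: hermitian_metric_def)
    show "J v \<in> V" if "v \<in> V" for v using that by (rule J_V)
    show "br v w = 0" if "v \<in> V" "w \<in> V" for v w using that V_N abelian_N by blast
    show "br U v = 0" if "v \<in> V" for v using that V_N abelian_N U_N by blast
    show "br (J U) v \<in> V" "br (J U) (J v) = J (br (J U) v)" if "v \<in> V" for v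
      using ad_V[OF br_JU[OF that] U_N that] br_JU[OF that] by simp_all
    show "br (J U) U = a *\<^sub>R U + (a *\<^sub>R p + w)"
      unfolding w(2) by (simp add: U_def scaleR_diff_right)
    show "a *\<^sub>R p + w \<in> V" using p w subspace_V by (simp add: subspace_add subspace_scale)
    show "U \<noteq> 0" using e1_V p(1) by (auto simp: U_def)
    show "g U v = 0" if "v \<in> V" for v using p(2)[OF that] by (simp add: U_def)
    show "\<exists>s t. \<exists>v\<in>V. x = s *\<^sub>R J U + t *\<^sub>R U + v" for x
    proof -
      obtain s k v where v: "v \<in> V" "x = s *\<^sub>R e (2 * n) + k *\<^sub>R e 1 + v" by (rule split)
      have "s *\<^sub>R J p + k *\<^sub>R p + v \<in> V"
        using p v J_V subspace_V by (simp add: subspace_add subspace_scale)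
      moreover have "x = s *\<^sub>R J U + k *\<^sub>R U + (s *\<^sub>R J p + k *\<^sub>R p + v)"
        unfolding v(2) JU by (simp add: U_def scaleR_diff_right)
      ultimately show ?thesis by blast
    qed
  qed
  have "D v = f v" if "v \<in> V" for v using br_JU[OF that] by (simp add: D_def)
  then have "normal_on V g D \<longleftrightarrow> normal_on V g f" "complex_spectrum V D = complex_spectrum V f"
    by (intro normal_on_cong complex_spectrum_cong, simp)+
  with twisted_SKT_iff show ?thesis by simp
qed

lemma normal_imp_diagonalizable:
  assumes "hermitian_metric J g" "normal_on V g f"
  shows "complex_diagonalizable V f"
proof -
  interpret inner_product_space g
    using assms finite_dim by unfold_locales (simp_all add: hermitian_metric_def)
  show ?thesis
    using assms(2) subspace_V linear_f by (rule normal_on_imp_complex_diagonalizable) (use f_V in blast)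
qed

lemma hermitian_normal_metric_exists:
  assumes "complex_diagonalizable V f"
  shows "\<exists>g. hermitian_metric J g \<and> normal_on V g f"
  using finite_dim linear_J J_J subspace_V J_V linear_f f_V f_J assms
  by (rule hermitian_normal_exists)

end

theorem theorem2p1:
  fixes br :: "'a::real_vector \<Rightarrow> 'a \<Rightarrow> 'a"
    and J :: "'a \<Rightarrow> 'a" and N :: "'a set"
    and n :: nat and e :: "nat \<Rightarrow> 'a"
  assumes "almost_abelian br N"
    and "dim (UNIV :: 'a set) = 2 * n"
    and "complex_structure br J"
    and "adapted_basis J N n e"
  shows "((\<exists>g. twisted_SKT br J g) \<longleftrightarrow>
            complex_diagonalizable (n1 J N) (br (e (2 * n))) \<and>
            (\<exists>\<mu>::real. \<forall>c \<in> complex_spectrum (n1 J N) (br (e (2 * n))). Re c \<in> {0, \<mu>})) \<and>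
         (complex_diagonalizable (n1 J N) (br (e (2 * n))) \<and>
            (\<exists>\<mu>::real. \<forall>c \<in> complex_spectrum (n1 J N) (br (e (2 * n))). Re c \<in> {0, \<mu>}) \<longrightarrow>
            {g. twisted_SKT br J g} =
            {g. hermitian_metric J g \<and> normal_on (n1 J N) g (br (e (2 * n)))})"
proof -
  interpret almost_abelian_adapted br J N n e
    using assms by unfold_locales
  \<comment> \<open>The spectral condition does not involve \<open>g\<close>, so existence reduces
    to finding a metric for which \<open>f\<close> is normal, and under the condition normality
    alone describes the metrics.\<close>
  define spec where "spec \<longleftrightarrow> (\<exists>\<mu>::real. \<forall>c \<in> complex_spectrum V f. Re c \<in> {0, \<mu>})"
  have "hermitian_metric J g" if "twisted_SKT br J g" for g
    using that by (simp add: twisted_SKT_def)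
  then have "twisted_SKT br J g \<longleftrightarrow> hermitian_metric J g \<and> normal_on V g f \<and> spec" for g
    using twisted_SKT_iff_normal[of g] unfolding spec_def by blast
  then show ?thesis
    unfolding spec_def[symmetric]
    using normal_imp_diagonalizable hermitian_normal_metric_exists by blast
qed

end
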